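(* Let $\mathbb{F}=\mathbb{R}$ or $\mathbb{C}$, let $n,m\in\mathbb{N}_+$ with $n>m$, and let $\Lambda=\mathrm{diag}(\lambda_1,\dots,\lambda_n)\in\mathbb{F}^{n\times n}$ with $|\lambda_1|>\dots>|\lambda_n|>0$. Assume $X\in\mathbb{F}^{n\times m}$ is such that $X(1:m,:)$ is invertible and all entries of $X(m+1:n,:)X(1:m,:)^{-1}$ are nonzero. Then there exist $M_6=M_6(n,m,\Lambda,X)>0$, $M_7=M_7(n,m,\Lambda,X)>0$ and $k_7=k_7(n,m,\Lambda,X)\in\mathbb{N}_+$ such that for every $k\geq k_7$: (1) The $m$ Ritz values of $\Lambda$ projected on $\mathrm{span}(\Lambda^kX)$ have distinct moduli; denote them by $\{\theta_j\}_{j\in[m]}$ with $|\theta_1|>\dots>|\theta_m|$. (2) Let $Z_k(:,j)$ be a unit Ritz vector corresponding to $\theta_j$. Then for every $j\in[m]$, \[ M_7\frac{|\lambda_{m+1}|^{2k}}{|\lambda_i|^k|\lambda_j|^k}\leq|Z_k(i,j)|\leq M_6\frac{|\lambda_{m+1}|^{2k}}{|\lambda_i|^k|\lambda_j|^k},\quad i\in[m]\setminus\{j\}; \] \[ M_7\frac{|\lambda_i|^k}{|\lambda_j|^k}\leq|Z_k(i,j)|\leq M_6\frac{|\lambda_i|^k}{|\lambda_j|^k},\quad i\in[n]\setminus[m]; \] \[ M_7\frac{|\lambda_{m+1}|^{2k}}{|\lambda_j|^{2k}}\leq1-|Z_k(j,j)|\leq M_6\frac{|\lambda_{m+1}|^{2k}}{|\lambda_j|^{2k}}.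 \]
   Context: Notation: $[r]=\{1,\dots,r\}$. $M(i,j)$ is the $(i,j)$ entry of $M$, $M(:,j)$ its $j$-th column, and $M(a:b,:)$ the submatrix of rows $a,\dots,b$. $\mathrm{span}(M)$ is the column space of $M$; here $\mathrm{span}(\Lambda^kX)$ has dimension $m$. For an $n\times n$ matrix $A$ and an $m$-dimensional subspace $\mathcal{S}\subseteq\mathbb{F}^n$ with basis matrix $\Phi\in\mathbb{F}^{n\times m}$ (columns a basis of $\mathcal{S}$), a Ritz pair of $A$ projected on $\mathcal{S}$ is $(\theta,z)$ with $z=\Phi y$, $y\ne0$ and $\Phi^*A\Phi y=\theta\,\Phi^*\Phi y$ (equivalently, when $\Phi=Q$ has orthonormal columns, $Q^*AQy=\theta y$); $\theta$ is a Ritz value and $z$ a Ritz vector. The $m$ Ritz values are counted with multiplicity. "Unit" refers to the Euclidean norm. *)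

theory Defs
  imports
    "HOL-Analysis.L2_Norm"
    "Jordan_Normal_Form.VS_Connect"
    "Jordan_Normal_Form.DL_Submatrix"
    "Jordan_Normal_Form.Schur_Decomposition"
begin

text \<open>
  Matrix and vector indices start at 0: row \<open>i\<close> of the text is row \<open>i - 1\<close> here, and
  \<open>\<lambda>\<^sub>m\<^sub>+\<^sub>1\<close> is \<open>lam m\<close>. The definitions are polymorphic in the scalar field and are meant
  for \<open>real\<close> (where \<^const>\<open>conjugate\<close> is the identity) and \<open>complex\<close>.
\<close>

text \<open>Independence is a property of the set of columns, so repeated columns have to be
  excluded separately.\<close>

definition basis_matrix :: "nat \<Rightarrow> nat \<Rightarrow> 'a::field mat \<Rightarrow> 'a vec set \<Rightarrow> bool" where
  "basis_matrix n m \<Phi> S \<longleftrightarrow>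
     \<Phi> \<in> carrier_mat n m \<and>
     distinct (cols \<Phi>) \<and>
     \<not> LinearCombinations.module.lin_dep class_ring (module_vec TYPE('a) n) (set (cols \<Phi>)) \<and>
     vec_space.col_space n \<Phi> = S"

definition ritz_pair ::
  "'a::conjugatable_field mat \<Rightarrow> 'a mat \<Rightarrow> 'a \<Rightarrow> 'a vec \<Rightarrow> bool" where
  "ritz_pair A \<Phi> \<theta> z \<longleftrightarrow>
     (\<exists>y \<in> carrier_vec (dim_col \<Phi>).
        y \<noteq> 0\<^sub>v (dim_col \<Phi>) \<and> z = \<Phi> *\<^sub>v y \<and>
        (mat_adjoint \<Phi> * A * \<Phi>) *\<^sub>v y = \<theta> \<cdot>\<^sub>v ((mat_adjoint \<Phi> * \<Phi>) *\<^sub>v y))"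

text \<open>The Ritz values with algebraic multiplicity. When \<open>\<Phi>\<close> has linearly independent columns
  its Gram matrix \<open>\<Phi>\<^sup>* \<Phi>\<close> is invertible, and the equation of a Ritz pair says that \<open>y\<close> is an
  eigenvector of \<open>(\<Phi>\<^sup>* \<Phi>)\<^sup>-\<^sup>1 (\<Phi>\<^sup>* A \<Phi>)\<close>; for orthonormal columns this is \<open>\<Phi>\<^sup>* A \<Phi>\<close>.
  Only roots in the field \<open>'a\<close> itself are collected, so over the reals the multiset having
  size \<open>m\<close> is part of what is claimed about it.\<close>

definition ritz_values ::
  "'a::conjugatable_field mat \<Rightarrow> 'a mat \<Rightarrow> 'a multiset" where
  "ritz_values A \<Phi> =
     proots (char_poly (the (mat_inverse (mat_adjoint \<Phi> * \<Phi>)) * (mat_adjoint \<Phi> * A * \<Phi>)))"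

definition euclidean_norm :: "'a::real_normed_vector vec \<Rightarrow> real" where
  "euclidean_norm z = L2_set (\<lambda>i. norm (z $ i)) {..<dim_vec z}"

end

theory Submission
  imports Defs "HOL-Computational_Algebra.Fundamental_Theorem_Algebra"
begin

text \<open>
  With \<open>W = X(m+1:n,:) X(1:m,:)\<^sup>-\<^sup>1\<close> the subspace \<open>span(\<Lambda>\<^sup>k X)\<close> is the graph of the map
  \<open>B\<^sub>l\<^sub>i = W\<^sub>l\<^sub>i \<lambda>\<^sub>l\<^sup>k / \<lambda>\<^sub>i\<^sup>k\<close>, which tends to zero. The Gram matrix of the graph basis therefore
  tends to the identity and the characteristic polynomial of the projected matrix tends to zero
  at each of \<open>\<lambda>\<^sub>1, \<dots>, \<lambda>\<^sub>m\<close>, which puts exactly one Ritz value into a small disc around each of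
  them.

  A Ritz vector \<open>z\<close> satisfies \<open>(\<theta> - \<lambda>\<^sub>i) z\<^sub>i = \<Sum>\<^sub>l conj(B\<^sub>l\<^sub>i) (\<lambda>\<^sub>l - \<theta>) z\<^sub>l\<close> for \<open>i \<le> m\<close> and
  \<open>z\<^sub>l = \<Sum>\<^sub>i B\<^sub>l\<^sub>i z\<^sub>i\<close> for \<open>l > m\<close>. Writing \<open>a\<^sub>i = |\<lambda>\<^sub>m\<^sub>+\<^sub>1/\<lambda>\<^sub>i|\<^sup>k\<close> and \<open>S = \<Sum>\<^sub>i a\<^sub>i |z\<^sub>i|\<close>, these equations
  give \<open>|z\<^sub>i| = O(a\<^sub>i S)\<close> for \<open>i \<noteq> j\<close>, so that \<open>S\<close> is dominated by its \<open>j\<close>-th term and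
  \<open>S \<le> 2 a\<^sub>j |z\<^sub>j|\<close>. Feeding this back into the equations isolates the leading terms
  \<open>B\<^sub>l\<^sub>j z\<^sub>j\<close> and \<open>conj(B\<^sub>l\<^sub>i) (\<lambda>\<^sub>l - \<theta>) z\<^sub>l\<close> with \<open>l = m + 1\<close>, which are nonzero since \<open>W\<close> has no zero entry.
\<close>

section \<open>Simple roots near prescribed points\<close>

text \<open>A polynomial has at most \<open>degree p\<close> roots with multiplicity, so
  \<open>m\<close> distinct ones exhaust the multiset and each of them is simple.\<close>

lemma proots_eq_mset_map:
  fixes p :: "'a::idom poly"
  assumes "p \<noteq> 0" and "degree p = m"
    and root: "\<And>j. j < m \<Longrightarrow> poly p (\<theta> j) = 0"
    and inj: "inj_on \<theta> {..<m}"
  shows "proots p = mset (map \<theta> [0..<m])"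
proof -
  have eq: "mset (map \<theta> [0..<m]) = mset_set (\<theta> ` {..<m})"
    using inj by (simp add: image_mset_mset_set lessThan_atLeast0)
  have "mset_set (\<theta> ` {..<m}) \<subseteq># mset_set (set_mset (proots p))"
    using assms poly_roots_finite[of p] by (intro subset_imp_msubset_mset_set) auto
  also have "\<dots> \<subseteq># proots p"
    by (rule mset_set_set_mset_msubset)
  finally have sub: "mset (map \<theta> [0..<m]) \<subseteq># proots p"
    using eq by simp
  moreover have "size (proots p) \<le> size (mset (map \<theta> [0..<m]))"
    using size_proots_le[of p] assms by simp
  ultimately show ?thesis
    by (metis mset_subset_size leD subset_mset.le_neq_trans)
qed

text \<open>Open discs of radius \<open>\<epsilon>\<close> about centres at distance at least
  \<open>2 * \<epsilon>\<close> are disjoint.\<close>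

lemma near_points_inj_on:
  fixes c \<theta> :: "nat \<Rightarrow> 'a::real_normed_vector"
  assumes sep: "\<And>i j. i < j \<Longrightarrow> j < m \<Longrightarrow> 2 * \<epsilon> \<le> norm (c i - c j)"
    and near: "\<And>j. j < m \<Longrightarrow> norm (\<theta> j - c j) < \<epsilon>"
  shows "inj_on \<theta> {..<m}"
proof (rule linorder_inj_onI)
  fix i j assume ij: "i < j" "i \<in> {..<m}" "j \<in> {..<m}"
  show "\<theta> i \<noteq> \<theta> j"
  proof
    assume "\<theta> i = \<theta> j"
    then have "norm (c i - c j) = norm ((\<theta> j - c j) - (\<theta> i - c i))" by simp
    also have "\<dots> \<le> norm (\<theta> j - c j) + norm (\<theta> i - c i)" by (rule norm_triangle_ineq4)
    also have "\<dots> < 2 * \<epsilon>" using near[of i] near[of j] ij by simp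
    finally show False using sep[of i j] ij by simp
  qed
qed auto

lemma prod_mset_ge_power:
  fixes f :: "'b \<Rightarrow> real"
  assumes "0 \<le> \<epsilon>" "\<And>x. x \<in># A \<Longrightarrow> \<epsilon> \<le> f x"
  shows "\<epsilon> ^ size A \<le> (\<Prod>x\<in>#A. f x)"
  using assms(2)
proof (induction A)
  case (add x A)
  then have "\<epsilon> \<le> f x" "\<epsilon> ^ size A \<le> (\<Prod>x\<in>#A. f x)" by auto
  then show ?case using assms(1) by (auto intro!: mult_mono)
qed simp

text \<open>The modulus of a monic complex polynomial at \<open>c\<close> is the product of the
  distances from \<open>c\<close> to its roots; if every root stayed \<open>\<epsilon>\<close> away,
  this product would be at least \<open>\<epsilon> ^ degree p\<close>.\<close>

lemma exists_near_root:
  fixes p :: "complex poly"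
  assumes "lead_coeff p = 1" and "0 \<le> \<epsilon>" and small: "norm (poly p c) < \<epsilon> ^ degree p"
  shows "\<exists>x. poly p x = 0 \<and> norm (x - c) < \<epsilon>"
proof (rule ccontr)
  assume no: "\<not> ?thesis"
  have p0: "p \<noteq> 0" using assms(1) by auto
  have "\<epsilon> ^ size (proots p) \<le> (\<Prod>x\<in>#proots p. norm (c - x))"
    using no p0 assms(2) by (intro prod_mset_ge_power) (auto simp: not_less norm_minus_commute)
  also have "\<dots> = norm (poly (\<Prod>x\<in>#proots p. [:-x, 1:]) c)"
  proof -
    have "(\<Prod>x\<in>#A. norm (c - x)) = norm (poly (\<Prod>x\<in>#A. [:-x, 1:]) c)" for A
      by (induction A) (simp_all add: norm_mult[symmetric] left_diff_distrib)
    then show ?thesis .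
  qed
  also have "(\<Prod>x\<in>#proots p. [:-x, 1:]) = p"
    using complex_poly_decompose_multiset[of p] assms(1) by simp
  finally show False using small by (simp add: size_proots_complex)
qed

text \<open>Each disc contains a root by \<open>exists_near_root\<close>, the discs are disjoint,
  and there are as many discs as the degree allows roots.\<close>

lemma complex_proots_near:
  fixes p :: "complex poly" and c :: "nat \<Rightarrow> complex"
  assumes monic: "lead_coeff p = 1" and deg: "degree p = m" and "0 \<le> \<epsilon>"
    and sep: "\<And>i j. i < j \<Longrightarrow> j < m \<Longrightarrow> 2 * \<epsilon> \<le> norm (c i - c j)"
    and small: "\<And>j. j < m \<Longrightarrow> norm (poly p (c j)) < \<epsilon> ^ m"
  shows "\<exists>\<theta>. proots p = mset (map \<theta> [0..<m]) \<and> (\<forall>j<m. norm (\<theta> j - c j) < \<epsilon>)"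
proof -
  have "\<exists>x. poly p x = 0 \<and> norm (x - c j) < \<epsilon>" if "j < m" for j
    using exists_near_root[OF monic \<open>0 \<le> \<epsilon>\<close>, of "c j"] small[OF that] deg by simp
  then obtain \<theta> where \<theta>: "\<And>j. j < m \<Longrightarrow> poly p (\<theta> j) = 0" "\<And>j. j < m \<Longrightarrow> norm (\<theta> j - c j) < \<epsilon>"
    by metis
  have "inj_on \<theta> {..<m}"
    by (rule near_points_inj_on[OF sep \<theta>(2)])
  moreover have "p \<noteq> 0" using monic by auto
  ultimately show ?thesis
    using proots_eq_mset_map[of p m \<theta>] deg \<theta> by blast
qed

text \<open>Each of the separated discs is symmetric about the real axis and contains exactly one root
  of the polynomial, which therefore equals its own conjugate.\<close>

lemma real_proots_near:
  fixes p :: "real poly" and c :: "nat \<Rightarrow> real"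
  assumes monic: "lead_coeff p = 1" and deg: "degree p = m" and "0 \<le> \<epsilon>"
    and sep: "\<And>i j. i < j \<Longrightarrow> j < m \<Longrightarrow> 2 * \<epsilon> \<le> norm (c i - c j)"
    and small: "\<And>j. j < m \<Longrightarrow> norm (poly p (c j)) < \<epsilon> ^ m"
  shows "\<exists>\<theta>. proots p = mset (map \<theta> [0..<m]) \<and> (\<forall>j<m. norm (\<theta> j - c j) < \<epsilon>)"
proof -
  let ?q = "map_poly complex_of_real p"
  let ?c = "\<lambda>j. complex_of_real (c j)"
  have poly_q: "poly ?q (of_real x) = of_real (poly p x)" for x
    by simp
  have degq: "degree ?q = m" using deg by simp
  have q0: "?q \<noteq> 0" and monq: "lead_coeff ?q = 1" using monic by auto
  have sepq: "2 * \<epsilon> \<le> norm (?c i - ?c j)" if "i < j" "j < m" for i j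
    using sep[OF that] by (metis norm_of_real of_real_diff real_norm_def)
  have "\<exists>\<theta>. proots ?q = mset (map \<theta> [0..<m]) \<and> (\<forall>j<m. norm (\<theta> j - ?c j) < \<epsilon>)"
    using small by (intro complex_proots_near[OF monq degq \<open>0 \<le> \<epsilon>\<close> sepq]) simp_all
  then obtain \<theta> where \<theta>: "proots ?q = mset (map \<theta> [0..<m])"
    and near: "\<And>j. j < m \<Longrightarrow> norm (\<theta> j - ?c j) < \<epsilon>" by blast
  have set_roots: "{x. poly ?q x = 0} = \<theta> ` {..<m}"
    using arg_cong[OF \<theta>, of set_mset] q0 by (simp add: lessThan_atLeast0)
  have real: "\<theta> j = of_real (Re (\<theta> j))" if j: "j < m" for j
  proof -
    have "poly ?q (\<theta> j) = 0" using set_roots j by blast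
    then have "poly ?q (cnj (\<theta> j)) = 0"
      using poly_cnj[of ?q "\<theta> j"] by (simp add: map_poly_map_poly o_def)
    then obtain i where i: "i < m" "cnj (\<theta> j) = \<theta> i" using set_roots by blast
    \<comment> \<open>The centre \<open>c j\<close> is real, so conjugation keeps the distance to
      it. The conjugate root is thus close to both \<open>c i\<close> and \<open>c j\<close>, and
      separation forces \<open>i = j\<close>.\<close>
    have "norm (\<theta> i - ?c j) < \<epsilon>"
      using near[OF j] complex_mod_cnj[of "\<theta> j - ?c j"] i by simp
    then have "norm (?c i - ?c j) < 2 * \<epsilon>"
      using near[OF i(1)] norm_triangle_ineq4[of "\<theta> i - ?c j" "\<theta> i - ?c i"] by simp
    then have "i = j"
      using sepq[of i j] sepq[of j i] i(1) j by (cases i j rule: linorder_cases) (auto simp: norm_minus_commute)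
    then show ?thesis using i by (simp add: complex_eq_iff)
  qed
  let ?r = "\<lambda>j. Re (\<theta> j)"
  have rnear: "norm (?r j - c j) < \<epsilon>" if "j < m" for j
    using near[OF that] real[OF that] by (metis norm_of_real of_real_diff real_norm_def)
  have "poly p (?r j) = 0" if "j < m" for j
  proof -
    have "poly ?q (of_real (?r j)) = 0"
      using set_roots that real[OF that] by force
    then show ?thesis unfolding poly_q by simp
  qed
  moreover have "inj_on ?r {..<m}"
    by (rule near_points_inj_on[OF sep rnear])
  moreover have "p \<noteq> 0" using monic by auto
  ultimately show ?thesis
    using proots_eq_mset_map[of p m ?r] deg rnear by blast
qed

section \<open>Componentwise bounds for Ritz vectors\<close>

text \<open>The estimates at one fixed \<open>k\<close>. The moduli of the matrix entries factor
  into a weight, a row decay \<open>b l\<close> and a column decay \<open>a i\<close>;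
  \<open>B'\<close> stands for the conjugate of \<open>B\<close>. All small quantities are collected
  in \<open>s\<close>, whose sum over \<open>b\<close> starts after row \<open>m\<close> because
  \<open>b m = 1\<close>; \<open>s1\<close> to \<open>s4\<close> are the conditions under which
  error terms can be absorbed.\<close>

lemma ritz_vector_bounds:
  fixes lam z :: "nat \<Rightarrow> 'a::real_normed_field" and B B' :: "nat \<Rightarrow> nat \<Rightarrow> 'a"
    and a b :: "nat \<Rightarrow> real" and w :: "nat \<Rightarrow> nat \<Rightarrow> real" and n m j :: nat
    and w\<^sub>0 W \<delta> T :: real
  defines "D \<equiv> real n * W\<^sup>2 * T / \<delta>"
  defines "s \<equiv> (\<Sum>i<m. (a i)\<^sup>2) + (\<Sum>l\<in>{m<..<n}. (b l)\<^sup>2)"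
  assumes mn: "m < n" and j: "j < m"
    and top: "\<And>i. i < m \<Longrightarrow> (\<theta> - lam i) * z i = (\<Sum>l=m..<n. B' l i * (lam l - \<theta>) * z l)"
    and bot: "\<And>l. l \<in> {m..<n} \<Longrightarrow> z l = (\<Sum>i<m. B l i * z i)"
    and normB: "\<And>l i. l \<in> {m..<n} \<Longrightarrow> i < m \<Longrightarrow> norm (B l i) = w l i * b l * a i"
    and normB': "\<And>l i. l \<in> {m..<n} \<Longrightarrow> i < m \<Longrightarrow> norm (B' l i) = w l i * b l * a i"
    and w0: "0 < w\<^sub>0" and w: "\<And>l i. l \<in> {m..<n} \<Longrightarrow> i < m \<Longrightarrow> w\<^sub>0 \<le> w l i \<and> w l i \<le> W"
    and a: "\<And>i. i < m \<Longrightarrow> 0 < a i \<and> a i \<le> 1"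
    and b: "\<And>l. l \<in> {m..<n} \<Longrightarrow> 0 < b l \<and> b l \<le> 1" and bm: "b m = 1"
    and \<delta>: "0 < \<delta>" and gap: "\<And>i. i \<le> m \<Longrightarrow> i \<noteq> j \<Longrightarrow> \<delta> \<le> norm (\<theta> - lam i)"
    and T: "0 < T" "\<And>i. i < n \<Longrightarrow> norm (\<theta> - lam i) \<le> T"
    and s1: "D * s \<le> 1 / 2" and s2: "4 * W * D * s \<le> w\<^sub>0"
    and s3: "8 * W\<^sup>2 * T * s \<le> w\<^sub>0\<^sup>2 * \<delta>" and s4: "real n * (2 * (D + W))\<^sup>2 * s \<le> 1 / 2"
    and unit: "(\<Sum>i<n. (norm (z i))\<^sup>2) = 1"
  shows "\<And>i. i < m \<Longrightarrow> i \<noteq> j \<Longrightarrow> norm (z i) \<le> 2 * D * (a i * a j)"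
    and "\<And>i. i < m \<Longrightarrow> i \<noteq> j \<Longrightarrow> w\<^sub>0\<^sup>2 * \<delta> / (8 * T) * (a i * a j) \<le> norm (z i)"
    and "\<And>l. l \<in> {m..<n} \<Longrightarrow> norm (z l) \<le> 2 * W * (b l * a j)"
    and "\<And>l. l \<in> {m..<n} \<Longrightarrow> w\<^sub>0 / 4 * (b l * a j) \<le> norm (z l)"
    and "1 - norm (z j) \<le> real n * (2 * (D + W))\<^sup>2 * (a j)\<^sup>2"
    and "w\<^sub>0\<^sup>2 / 32 * (a j)\<^sup>2 \<le> 1 - norm (z j)"
proof -

  \<comment> \<open>Bounds in terms of the weighted sum \<open>S\<close>\<close>
  define S where "S = (\<Sum>i<m. a i * norm (z i))"
  define r where "r = a j * norm (z j)"
  have m0: "m \<in> {m..<n}" using mn by simp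
  have n0: "0 < n" using mn by simp
  have W0: "0 < W" using w[OF m0 j] w0 by linarith
  have D0: "0 < D" unfolding D_def using W0 T(1) \<delta> n0 by simp
  have s0: "0 \<le> s" unfolding s_def by (intro add_nonneg_nonneg sum_nonneg) auto
  have sa: "(\<Sum>i\<in>I. (a i)\<^sup>2) \<le> s" if "I \<subseteq> {..<m}" for I
  proof -
    have "(\<Sum>i\<in>I. (a i)\<^sup>2) \<le> (\<Sum>i<m. (a i)\<^sup>2)" using that by (intro sum_mono2) auto
    then show ?thesis unfolding s_def by (smt (verit) sum_nonneg zero_le_power2)
  qed
  have sb: "(\<Sum>l\<in>{m<..<n}. (b l)\<^sup>2) \<le> s"
    unfolding s_def by (smt (verit) sum_nonneg zero_le_power2)
  have S0: "0 \<le> S" unfolding S_def using a by (intro sum_nonneg) (simp add: less_imp_le)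
  have wle: "w l i * b l * a i \<le> W * b l * a i" if "l \<in> {m..<n}" "i < m" for l i
    using w[OF that] a[OF that(2)] b[OF that(1)] by (simp add: mult_right_mono)
  have zl_S: "norm (z l) \<le> W * b l * S" if l: "l \<in> {m..<n}" for l
  proof -
    have "norm (z l) \<le> (\<Sum>i<m. norm (B l i * z i))"
      unfolding bot[OF l] by (rule norm_sum)
    also have "\<dots> \<le> (\<Sum>i<m. W * b l * (a i * norm (z i)))"
    proof (rule sum_mono)
      fix i assume i: "i \<in> {..<m}"
      have "norm (B l i * z i) = w l i * b l * a i * norm (z i)"
        using normB[OF l, of i] i by (simp add: norm_mult)
      also have "\<dots> \<le> W * b l * a i * norm (z i)"
        using mult_right_mono[OF wle[OF l, of i], of "norm (z i)"] i by simp
      finally show "norm (B l i * z i) \<le> W * b l * (a i * norm (z i))" by (simp add: mult.assoc)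
    qed
    finally show ?thesis unfolding S_def by (simp add: sum_distrib_left)
  qed
  \<comment> \<open>The top equation is divided by the gap \<open>\<delta>\<close>. Each of at most
    \<open>n\<close> summands is bounded by \<open>W * a i\<close> for the matrix entry,
    \<open>T\<close> for the factor \<open>lam l - \<theta>\<close> and \<open>W * S\<close> for
    \<open>z l\<close>; this is the origin of \<open>D\<close>.\<close>
  have zi_S: "norm (z i) \<le> D * a i * S" if i: "i < m" "i \<noteq> j" for i
  proof -
    have "\<delta> * norm (z i) \<le> norm ((\<theta> - lam i) * z i)"
      unfolding norm_mult using gap[of i] i by (intro mult_right_mono) auto
    also have "\<dots> \<le> (\<Sum>l=m..<n. norm (B' l i * (lam l - \<theta>) * z l))"
      unfolding top[OF i(1)] by (rule norm_sum)
    also have "\<dots> \<le> (\<Sum>l=m..<n. W * a i * T * (W * S))"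
    proof (rule sum_mono)
      fix l assume l: "l \<in> {m..<n}"
      have bl: "0 < b l" "b l \<le> 1" using b[OF l] by auto
      have ai: "0 < a i" using a[OF i(1)] by simp
      have "norm (B' l i) \<le> W * a i"
      proof -
        have "norm (B' l i) \<le> W * b l * a i" using normB'[OF l i(1)] wle[OF l i(1)] by simp
        also have "\<dots> \<le> W * 1 * a i" using bl ai W0 by (intro mult_mono) auto
        finally show ?thesis by simp
      qed
      moreover have "norm (z l) \<le> W * S"
      proof -
        have "norm (z l) \<le> W * b l * S" by (rule zl_S[OF l])
        also have "\<dots> \<le> W * 1 * S" using bl S0 W0 by (intro mult_mono) auto
        finally show ?thesis by simp
      qed
      moreover have "norm (lam l - \<theta>) \<le> T" using T(2)[of l] l by (simp add: norm_minus_commute)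
      ultimately show "norm (B' l i * (lam l - \<theta>) * z l) \<le> W * a i * T * (W * S)"
        unfolding norm_mult using W0 ai T(1) S0 by (intro mult_mono) auto
    qed
    also have "\<dots> = real (n - m) * (W * a i * T * (W * S))" by simp
    also have "\<dots> \<le> real n * (W * a i * T * (W * S))"
      using W0 a[OF i(1)] T(1) S0 by (intro mult_right_mono) auto
    finally have "norm (z i) \<le> real n * (W * a i * T * (W * S)) / \<delta>"
      using \<delta> by (simp add: field_simps)
    then show ?thesis unfolding D_def by (simp add: power2_eq_square field_simps)
  qed

  \<comment> \<open>Dominance of the \<open>j\<close>-th term and isolation of the leading
    terms\<close>
  let ?J = "{..<m} - {j}"
  have split: "(\<Sum>i<m. f i) = f j + (\<Sum>i\<in>?J. f i)" for f :: "nat \<Rightarrow> 'b::comm_monoid_add"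
    using j by (simp add: sum.remove)
  \<comment> \<open>A summand with \<open>i \<noteq> j\<close> carries \<open>a i\<close> twice,
    once as weight in \<open>S\<close> and once from the bound on \<open>z i\<close>, so the
    remainder is of order \<open>s * S\<close>.\<close>
  have rest: "(\<Sum>i\<in>?J. a i * norm (z i)) \<le> D * s * S"
  proof -
    have "(\<Sum>i\<in>?J. a i * norm (z i)) \<le> (\<Sum>i\<in>?J. (a i)\<^sup>2 * (D * S))"
    proof (rule sum_mono)
      fix i assume i: "i \<in> ?J"
      then have "a i * norm (z i) \<le> a i * (D * a i * S)"
        using zi_S[of i] a[of i] by (intro mult_left_mono) auto
      then show "a i * norm (z i) \<le> (a i)\<^sup>2 * (D * S)"
        by (simp add: power2_eq_square mult_ac)
    qed
    also have "\<dots> = (\<Sum>i\<in>?J. (a i)\<^sup>2) * (D * S)" by (simp add: sum_distrib_right)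
    also have "\<dots> \<le> s * (D * S)" using sa[of ?J] D0 S0 by (intro mult_right_mono) auto
    finally show ?thesis by (simp add: mult_ac)
  qed
  \<comment> \<open>By \<open>s1\<close> the remainder is at most half of \<open>S\<close> and is
    absorbed on the left.\<close>
  have S_r: "S \<le> 2 * r"
  proof -
    have "S = r + (\<Sum>i\<in>?J. a i * norm (z i))" unfolding S_def r_def by (rule split)
    also have "\<dots> \<le> r + 1/2 * S" using rest mult_right_mono[OF s1 S0] by linarith
    finally show ?thesis by simp
  qed
  have r0: "0 \<le> r" unfolding r_def using a[OF j] by simp
  have zi_r: "norm (z i) \<le> 2 * D * a i * r" if i: "i < m" "i \<noteq> j" for i
  proof -
    have "D * a i * S \<le> D * a i * (2 * r)" using S_r D0 a[OF i(1)] by (intro mult_left_mono) auto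
    then show ?thesis using zi_S[OF i] by simp
  qed
  have zl_r: "norm (z l) \<le> 2 * W * b l * r" if l: "l \<in> {m..<n}" for l
  proof -
    have "W * b l * S \<le> W * b l * (2 * r)" using S_r W0 b[OF l] by (intro mult_left_mono) auto
    then show ?thesis using zl_S[OF l] by simp
  qed
  \<comment> \<open>The term \<open>B l j * z j\<close> has modulus at least
    \<open>w\<^sub>0 * b l * r\<close>; by \<open>s2\<close> the other terms together take away at
    most half of that.\<close>
  have zl_lower: "w\<^sub>0 / 2 * b l * r \<le> norm (z l)" if l: "l \<in> {m..<n}" for l
  proof -
    have bl: "0 < b l" using b[OF l] by simp
    have "z l - B l j * z j = (\<Sum>i\<in>?J. B l i * z i)"
      unfolding bot[OF l] by (subst split) simp
    then have "norm (z l - B l j * z j) \<le> (\<Sum>i\<in>?J. norm (B l i * z i))"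
      by (simp add: norm_sum)
    also have "\<dots> \<le> (\<Sum>i\<in>?J. W * b l * (a i * norm (z i)))"
    proof (rule sum_mono)
      fix i assume i: "i \<in> ?J"
      have "norm (B l i * z i) = w l i * b l * a i * norm (z i)"
        using normB[OF l, of i] i by (simp add: norm_mult)
      also have "\<dots> \<le> W * b l * a i * norm (z i)"
        using mult_right_mono[OF wle[OF l, of i], of "norm (z i)"] i by simp
      finally show "norm (B l i * z i) \<le> W * b l * (a i * norm (z i))" by (simp add: mult.assoc)
    qed
    also have "\<dots> = W * b l * (\<Sum>i\<in>?J. a i * norm (z i))" by (simp add: sum_distrib_left)
    also have "\<dots> \<le> W * b l * (D * s * (2 * r))"
    proof -
      have "D * s * S \<le> D * s * (2 * r)" using S_r D0 s0 by (intro mult_left_mono) auto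
      then show ?thesis using rest W0 bl by (intro mult_left_mono) auto
    qed
    also have "\<dots> = (4 * W * D * s) * (b l * r / 2)" by simp
    also have "\<dots> \<le> w\<^sub>0 * (b l * r / 2)" using s2 bl r0 by (intro mult_right_mono) auto
    finally have e: "norm (z l - B l j * z j) \<le> w\<^sub>0 * (b l * r / 2)" .
    have "w\<^sub>0 * (b l * r) \<le> w l j * (b l * r)"
      using w[OF l j] bl r0 by (intro mult_right_mono) auto
    also have "\<dots> = norm (B l j * z j)"
      unfolding norm_mult normB[OF l j] r_def by simp
    finally have "w\<^sub>0 * (b l * r) \<le> norm (B l j * z j)" .
    then show ?thesis using e norm_triangle_ineq2[of "B l j * z j" "z l"]
      by (simp add: norm_minus_commute)
  qed
  \<comment> \<open>The summand \<open>l = m\<close> leads. Those with \<open>l > m\<close> carry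
    \<open>b l\<close> twice, from \<open>B' l i\<close> and from \<open>z l\<close>, so
    \<open>s3\<close> keeps their sum below half of the lower bound for the leading one.\<close>
  have zi_lower: "w\<^sub>0\<^sup>2 * \<delta> / (4 * T) * a i * r \<le> norm (z i)" if i: "i < m" "i \<noteq> j" for i
  proof -
    have ai: "0 < a i" using a[OF i(1)] by simp
    let ?t = "\<lambda>l. B' l i * (lam l - \<theta>) * z l"
    have "{m..<n} = insert m {m<..<n}" using mn by auto
    then have "(\<theta> - lam i) * z i - ?t m = (\<Sum>l\<in>{m<..<n}. ?t l)"
      unfolding top[OF i(1)] by simp
    then have "norm ((\<theta> - lam i) * z i - ?t m) \<le> (\<Sum>l\<in>{m<..<n}. norm (?t l))"
      by (simp add: norm_sum)
    also have "\<dots> \<le> (\<Sum>l\<in>{m<..<n}. (b l)\<^sup>2 * (2 * W\<^sup>2 * T * a i * r))"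
    proof (rule sum_mono)
      fix l assume "l \<in> {m<..<n}"
      then have l: "l \<in> {m..<n}" by auto
      have bl: "0 < b l" using b[OF l] by simp
      have "norm (B' l i) \<le> W * b l * a i" using normB'[OF l i(1)] wle[OF l i(1)] by simp
      moreover have "norm (lam l - \<theta>) \<le> T" using T(2)[of l] l by (simp add: norm_minus_commute)
      ultimately have "norm (?t l) \<le> W * b l * a i * T * (2 * W * b l * r)"
        unfolding norm_mult using W0 ai T(1) bl r0 zl_r[OF l] by (intro mult_mono) auto
      then show "norm (?t l) \<le> (b l)\<^sup>2 * (2 * W\<^sup>2 * T * a i * r)"
        by (simp add: power2_eq_square mult_ac)
    qed
    also have "\<dots> = (\<Sum>l\<in>{m<..<n}. (b l)\<^sup>2) * (2 * W\<^sup>2 * T * a i * r)" by (simp add: sum_distrib_right)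
    also have "\<dots> \<le> s * (2 * W\<^sup>2 * T * a i * r)"
      using sb W0 T(1) ai r0 by (intro mult_right_mono) auto
    also have "\<dots> = (8 * W\<^sup>2 * T * s) * (a i * r / 4)" by simp
    also have "\<dots> \<le> w\<^sub>0\<^sup>2 * \<delta> * (a i * r / 4)" using s3 ai r0 by (intro mult_right_mono) auto
    finally have e: "norm ((\<theta> - lam i) * z i - ?t m) \<le> w\<^sub>0\<^sup>2 * \<delta> * (a i * r / 4)" .
    have "w\<^sub>0 * a i * \<delta> * (w\<^sub>0 / 2 * r) \<le> norm (B' m i) * norm (lam m - \<theta>) * norm (z m)"
    proof (intro mult_mono)
      show "w\<^sub>0 * a i \<le> norm (B' m i)"
        using normB'[OF m0 i(1)] w[OF m0 i(1)] bm ai by (simp add: mult_right_mono)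
      \<comment> \<open>This factor is the reason why \<open>gap\<close> includes the index
        \<open>m\<close>: the leading term must not vanish through \<open>\<theta>\<close>
        approaching \<open>lam m\<close>.\<close>
      show "\<delta> \<le> norm (lam m - \<theta>)" using gap[of m] j by (simp add: norm_minus_commute)
      show "w\<^sub>0 / 2 * r \<le> norm (z m)" using zl_lower[OF m0] bm by simp
    qed (use w0 ai \<delta> r0 in auto)
    also have "\<dots> = norm (?t m)" by (simp add: norm_mult)
    finally have "w\<^sub>0\<^sup>2 * \<delta> * (a i * r / 2) \<le> norm (?t m)" by (simp add: power2_eq_square mult_ac)
    then have "w\<^sub>0\<^sup>2 * \<delta> * (a i * r / 4) \<le> norm ((\<theta> - lam i) * z i)"
      using e norm_triangle_ineq2[of "?t m" "(\<theta> - lam i) * z i"]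
      by (simp add: norm_minus_commute)
    also have "\<dots> \<le> T * norm (z i)"
      unfolding norm_mult using T(2)[of i] i mn by (intro mult_right_mono) auto
    finally show ?thesis using T(1) by (simp add: field_simps)
  qed

  \<comment> \<open>Normalization, replacing \<open>r\<close> by \<open>a j\<close>\<close>
  let ?E = "2 * (D + W)"
  have zj: "(norm (z j))\<^sup>2 + (\<Sum>i\<in>{..<n} - {j}. (norm (z i))\<^sup>2) = 1"
    using unit j mn by (simp add: sum.remove[of "{..<n}" j])
  have zj1: "norm (z j) \<le> 1"
  proof -
    have "(norm (z j))\<^sup>2 \<le> 1\<^sup>2" using zj sum_nonneg[of "{..<n} - {j}" "\<lambda>i. (norm (z i))\<^sup>2"] by simp
    then show ?thesis by (rule power2_le_imp_le) simp
  qed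
  have r_aj: "r \<le> a j" unfolding r_def using zj1 a[OF j] by (simp add: mult_left_le)
  have others: "norm (z i) \<le> ?E * a j" if "i < n" "i \<noteq> j" for i
  proof -
    have "norm (z i) \<le> ?E * 1 * r"
    proof (cases "i < m")
      case True
      have "2 * D * a i * r \<le> ?E * 1 * r"
        using a[OF True] D0 W0 r0 by (intro mult_right_mono mult_mono) auto
      then show ?thesis using zi_r[OF True that(2)] by linarith
    next
      case False
      then have i: "i \<in> {m..<n}" using that by simp
      have "2 * W * b i * r \<le> ?E * 1 * r"
        using b[OF i] D0 W0 r0 by (intro mult_right_mono mult_mono) auto
      then show ?thesis using zl_r[OF i] by linarith
    qed
    also have "\<dots> \<le> ?E * 1 * a j" using r_aj D0 W0 by (intro mult_left_mono) auto
    finally show ?thesis by simp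
  qed
  have defect: "1 - (norm (z j))\<^sup>2 \<le> real n * ?E\<^sup>2 * (a j)\<^sup>2"
  proof -
    have "1 - (norm (z j))\<^sup>2 = (\<Sum>i\<in>{..<n} - {j}. (norm (z i))\<^sup>2)" using zj by linarith
    also have "\<dots> \<le> (\<Sum>i\<in>{..<n} - {j}. (?E * a j)\<^sup>2)"
      using others by (intro sum_mono power_mono) auto
    also have "\<dots> = real (card ({..<n} - {j})) * (?E * a j)\<^sup>2" by simp
    also have "\<dots> \<le> real n * (?E * a j)\<^sup>2"
      using card_Diff1_le[of "{..<n}" j] by (intro mult_right_mono) auto
    finally show ?thesis by (simp add: power_mult_distrib mult.assoc)
  qed
  \<comment> \<open>Hence \<open>1 - norm (z j)\<close> is at most the defect of the square, which
    is the mass of the other components.\<close>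
  have sq_le: "(norm (z j))\<^sup>2 \<le> norm (z j)"
    using zj1 by (simp add: power2_eq_square mult_left_le)
  show fin5: "1 - norm (z j) \<le> real n * (2 * (D + W))\<^sup>2 * (a j)\<^sup>2"
    using defect sq_le by linarith
  have "(a j)\<^sup>2 \<le> s" using sa[of "{j}"] j by simp
  then have "real n * ?E\<^sup>2 * (a j)\<^sup>2 \<le> real n * ?E\<^sup>2 * s"
    by (intro mult_left_mono) auto
  \<comment> \<open>Now \<open>r\<close> lies between \<open>a j / 2\<close> and \<open>a j\<close>,
    so every bound in \<open>r\<close> becomes one in \<open>a j\<close>; the lower bounds lose
    another factor 2.\<close>
  then have half: "1 / 2 \<le> norm (z j)" using fin5 s4 by linarith
  have aj_r: "a j / 2 \<le> r"
    unfolding r_def using half a[OF j] mult_left_mono[of "1/2" "norm (z j)" "a j"] by simp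
  show "norm (z i) \<le> 2 * D * (a i * a j)" if "i < m" "i \<noteq> j" for i
  proof -
    have "2 * D * a i * r \<le> 2 * D * a i * a j"
      using r_aj D0 a[OF that(1)] by (intro mult_left_mono) auto
    then show ?thesis using zi_r[OF that] by (simp add: mult.assoc)
  qed
  show "w\<^sub>0\<^sup>2 * \<delta> / (8 * T) * (a i * a j) \<le> norm (z i)" if "i < m" "i \<noteq> j" for i
  proof -
    have "w\<^sub>0\<^sup>2 * \<delta> / (4 * T) * a i * (a j / 2) \<le> w\<^sub>0\<^sup>2 * \<delta> / (4 * T) * a i * r"
      using aj_r w0 \<delta> T(1) a[OF that(1)] by (intro mult_left_mono) auto
    then show ?thesis using zi_lower[OF that] by simp
  qed
  show "norm (z l) \<le> 2 * W * (b l * a j)" if "l \<in> {m..<n}" for l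
  proof -
    have "2 * W * b l * r \<le> 2 * W * b l * a j"
      using r_aj W0 b[OF that] by (intro mult_left_mono) auto
    then show ?thesis using zl_r[OF that] by (simp add: mult.assoc)
  qed
  show fin4: "w\<^sub>0 / 4 * (b l * a j) \<le> norm (z l)" if "l \<in> {m..<n}" for l
  proof -
    have "w\<^sub>0 / 2 * b l * (a j / 2) \<le> w\<^sub>0 / 2 * b l * r"
      using aj_r w0 b[OF that] by (intro mult_left_mono) auto
    then show ?thesis using zl_lower[OF that] by (simp add: mult_ac)
  qed
  show "w\<^sub>0\<^sup>2 / 32 * (a j)\<^sup>2 \<le> 1 - norm (z j)"
  proof -
    \<comment> \<open>The single component \<open>z m\<close> already accounts for a defect of the
      required order. The square of \<open>w\<^sub>0 / 4\<close> and the factor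
      \<open>1 + norm (z j) \<le> 2\<close> yield the constant 32.\<close>
    have "(w\<^sub>0 / 4 * a j)\<^sup>2 \<le> (norm (z m))\<^sup>2"
      using fin4[OF m0] bm w0 a[OF j] by (intro power_mono) auto
    also have "\<dots> \<le> (\<Sum>i\<in>{..<n} - {j}. (norm (z i))\<^sup>2)"
      using mn j by (intro member_le_sum) auto
    also have "\<dots> = (1 - norm (z j)) * (1 + norm (z j))"
      using zj by (simp add: power2_eq_square algebra_simps)
    also have "\<dots> \<le> (1 - norm (z j)) * 2"
      using zj1 by (intro mult_left_mono) auto
    finally show ?thesis by (simp add: power2_eq_square mult_ac)
  qed
qed

section \<open>Gram matrices and Ritz pairs of a graph subspace\<close>

lemma mult_mat_index_sum:
  assumes A: "A \<in> carrier_mat n m" and B: "B \<in> carrier_mat m r" and "i < n" "j < r"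
  shows "(A * B) $$ (i, j) = (\<Sum>l<m. A $$ (i, l) * B $$ (l, j))"
proof -
  have "(A * B) $$ (i, j) = row A i \<bullet> col B j" using assms by simp
  also have "\<dots> = (\<Sum>l<m. A $$ (i, l) * B $$ (l, j))"
    unfolding scalar_prod_def using assms by (auto simp: lessThan_atLeast0 intro!: sum.cong)
  finally show ?thesis .
qed

lemma mult_mat_vec_index_sum:
  assumes A: "A \<in> carrier_mat n m" and v: "v \<in> carrier_vec m" and "i < n"
  shows "(A *\<^sub>v v) $ i = (\<Sum>l<m. A $$ (i, l) * v $ l)"
proof -
  have "(A *\<^sub>v v) $ i = row A i \<bullet> v" using assms by simp
  also have "\<dots> = (\<Sum>l<m. A $$ (i, l) * v $ l)"
    unfolding scalar_prod_def using assms by (auto simp: lessThan_atLeast0 intro!: sum.cong)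
  finally show ?thesis .
qed

lemma mat_adjoint_carrier [simp]:
  "A \<in> carrier_mat n m \<Longrightarrow> mat_adjoint A \<in> carrier_mat m n"
  unfolding mat_adjoint_def carrier_mat_def by simp

lemma dim_mat_adjoint [simp]:
  "dim_row (mat_adjoint A) = dim_col A" "dim_col (mat_adjoint A) = dim_row A"
  unfolding mat_adjoint_def by simp_all

lemma mat_adjoint_index:
  "A \<in> carrier_mat n m \<Longrightarrow> i < m \<Longrightarrow> l < n \<Longrightarrow> mat_adjoint A $$ (i, l) = conjugate (A $$ (l, i))"
  unfolding mat_adjoint_def by (simp add: mat_of_rows_def)

lemma mat_adjoint_mult:
  assumes A: "A \<in> carrier_mat n m" and B: "B \<in> carrier_mat m r"
  shows "mat_adjoint (A * B) = mat_adjoint B * mat_adjoint A"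
proof (rule eq_matI)
  fix i j assume ij: "i < dim_row (mat_adjoint B * mat_adjoint A)" "j < dim_col (mat_adjoint B * mat_adjoint A)"
  then have i: "i < r" and j: "j < n"
    using mat_adjoint_carrier[OF A] mat_adjoint_carrier[OF B] by auto
  have "mat_adjoint (A * B) $$ (i, j) = conjugate ((A * B) $$ (j, i))"
    by (rule mat_adjoint_index[OF mult_carrier_mat[OF A B] i j])
  also have "(A * B) $$ (j, i) = (\<Sum>l<m. A $$ (j, l) * B $$ (l, i))"
    by (rule mult_mat_index_sum[OF A B j i])
  also have "conjugate \<dots> = (\<Sum>l<m. mat_adjoint B $$ (i, l) * mat_adjoint A $$ (l, j))"
    using i j by (simp add: sum_conjugate conjugate_dist_mul mat_adjoint_index[OF A] mat_adjoint_index[OF B] mult.commute)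
  also have "\<dots> = (mat_adjoint B * mat_adjoint A) $$ (i, j)"
    by (rule mult_mat_index_sum[OF mat_adjoint_carrier[OF B] mat_adjoint_carrier[OF A] i j, symmetric])
  finally show "mat_adjoint (A * B) $$ (i, j) = (mat_adjoint B * mat_adjoint A) $$ (i, j)" .
qed simp_all

text \<open>Conjugation is multiplicative and does not annihilate 1, so the image of 1 is a nonzero
  idempotent of a field.\<close>

lemma conjugate_one [simp]: "conjugate (1::'a::conjugatable_field) = 1"
proof -
  have "conjugate (1::'a) * conjugate 1 = conjugate 1 * 1"
    by (simp add: conjugate_dist_mul[symmetric])
  moreover have "conjugate (1::'a) \<noteq> 0" by simp
  ultimately show ?thesis by (metis mult_left_cancel)
qed

lemma mat_adjoint_one [simp]: "mat_adjoint (1\<^sub>m n :: 'a::conjugatable_field mat) = 1\<^sub>m n"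
proof (rule eq_matI)
  fix i j assume "i < dim_row (1\<^sub>m n :: 'a mat)" "j < dim_col (1\<^sub>m n :: 'a mat)"
  then show "mat_adjoint (1\<^sub>m n :: 'a mat) $$ (i, j) = 1\<^sub>m n $$ (i, j)"
    by (subst mat_adjoint_index[of _ n n]) auto
qed simp_all

text \<open>By the Leibniz formula the determinant is a finite sum of products of entries.\<close>

lemma tendsto_det:
  fixes A :: "'b \<Rightarrow> 'a::real_normed_field mat"
  assumes A: "\<And>k. A k \<in> carrier_mat m m" and L: "L \<in> carrier_mat m m"
    and lim: "\<And>i j. i < m \<Longrightarrow> j < m \<Longrightarrow> ((\<lambda>k. A k $$ (i, j)) \<longlongrightarrow> L $$ (i, j)) F"
  shows "((\<lambda>k. det (A k)) \<longlongrightarrow> det L) F"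
  unfolding det_def'[OF A] det_def'[OF L]
proof (intro tendsto_sum tendsto_mult tendsto_const tendsto_prod lim)
  fix p i assume "p \<in> {p. p permutes {0..<m}}" "i \<in> {0..<m}"
  then show "i < m" "p i < m" using permutes_in_image[of p "{0..<m}" i] by auto
qed

text \<open>One form covers the three matrices of the projected problem: weight 1 gives the Gram
  matrix, weight \<open>lam\<close> the compression of the diagonal matrix, and weight
  \<open>x - lam l\<close> the pencil whose determinant vanishes at the Ritz values.\<close>

definition weighted_gram :: "(nat \<Rightarrow> 'a::conjugatable_field) \<Rightarrow> 'a mat \<Rightarrow> 'a mat" where
  "weighted_gram f E = mat_adjoint E * mat_diag (dim_row E) f * E"

lemma weighted_gram_carrier [simp]: "E \<in> carrier_mat n m \<Longrightarrow> weighted_gram f E \<in> carrier_mat m m"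
  unfolding weighted_gram_def by (metis carrier_matD(1) mat_adjoint_carrier mat_diag_dim mult_carrier_mat)

lemma weighted_gram_index:
  assumes E: "E \<in> carrier_mat n m" and "i < m" "j < m"
  shows "weighted_gram f E $$ (i, j) = (\<Sum>l<n. conjugate (E $$ (l, i)) * f l * E $$ (l, j))"
proof -
  have "weighted_gram f E = mat_adjoint E * mat_diag n f * E"
    using E unfolding weighted_gram_def by simp
  also have "\<dots> $$ (i, j) = (\<Sum>l<n. (mat_adjoint E * mat_diag n f) $$ (i, l) * E $$ (l, j))"
    by (rule mult_mat_index_sum[OF mult_carrier_mat[OF mat_adjoint_carrier[OF E] mat_diag_dim] E assms(2,3)])
  also have "\<dots> = (\<Sum>l<n. conjugate (E $$ (l, i)) * f l * E $$ (l, j))"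
    using assms by (simp add: mat_diag_mult_right[OF mat_adjoint_carrier[OF E]] mat_adjoint_index[OF E])
  finally show ?thesis .
qed

lemma weighted_gram_one:
  assumes "E \<in> carrier_mat n m"
  shows "weighted_gram (\<lambda>_. 1) E = mat_adjoint E * E"
  using right_mult_one_mat[OF mat_adjoint_carrier[OF assms]] assms by (simp add: weighted_gram_def)

lemma weighted_gram_diff:
  assumes E: "E \<in> carrier_mat n m"
  shows "weighted_gram (\<lambda>l. x - f l) E = x \<cdot>\<^sub>m weighted_gram (\<lambda>_. 1) E - weighted_gram f E"
  (is "?l = ?r")
proof (rule eq_matI)
  have d: "dim_row (weighted_gram g E) = m" "dim_col (weighted_gram g E) = m" for g
    using weighted_gram_carrier[OF E] by auto
  show "dim_row ?l = dim_row ?r" "dim_col ?l = dim_col ?r" by (simp_all add: d)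
  fix i j assume "i < dim_row ?r" "j < dim_col ?r"
  then have ij: "i < m" "j < m" by (simp_all add: d)
  then show "?l $$ (i, j) = ?r $$ (i, j)"
    by (simp add: d weighted_gram_index[OF E] sum_distrib_left sum_subtractf[symmetric] algebra_simps)
qed

lemma weighted_gram_mult:
  assumes E: "E \<in> carrier_mat n m" and U: "U \<in> carrier_mat m r"
  shows "weighted_gram f (E * U) = mat_adjoint U * weighted_gram f E * U"
proof -
  note Us = mat_adjoint_carrier[OF U]
  have D: "mat_diag n f \<in> carrier_mat n n" by simp
  note Y = mult_carrier_mat[OF mat_adjoint_carrier[OF E] D]
  have "weighted_gram f (E * U) = mat_adjoint U * mat_adjoint E * mat_diag n f * (E * U)"
    using E by (simp add: weighted_gram_def mat_adjoint_mult[OF E U])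
  also have "\<dots> = mat_adjoint U * (mat_adjoint E * mat_diag n f) * (E * U)"
    by (simp add: assoc_mult_mat[OF Us mat_adjoint_carrier[OF E] D])
  also have "\<dots> = mat_adjoint U * (mat_adjoint E * mat_diag n f) * E * U"
    by (rule assoc_mult_mat[symmetric, OF mult_carrier_mat[OF Us Y] E U])
  also have "mat_adjoint U * (mat_adjoint E * mat_diag n f) * E = mat_adjoint U * (mat_adjoint E * mat_diag n f * E)"
    by (rule assoc_mult_mat[OF Us Y E])
  finally show ?thesis using E by (simp add: weighted_gram_def)
qed

text \<open>Multiplying the characteristic matrix of \<open>(\<Phi>\<^sup>* \<Phi>)\<^sup>-\<^sup>1 (\<Phi>\<^sup>* A \<Phi>)\<close> by \<open>\<Phi>\<^sup>* \<Phi>\<close> removes the inverse;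
  the change of basis \<open>U\<close> then contributes the same factor to both determinants.\<close>

lemma poly_char_poly_ritz:
  fixes E :: "'a::conjugatable_field mat" and lam :: "nat \<Rightarrow> 'a"
  assumes E: "E \<in> carrier_mat n m" and U: "U \<in> carrier_mat m m" and V: "V \<in> carrier_mat m m"
    and UV: "U * V = 1\<^sub>m m" and G0: "det (weighted_gram (\<lambda>_. 1) E) \<noteq> 0"
    and \<Phi>: "\<Phi> = E * U"
  defines "C \<equiv> the (mat_inverse (mat_adjoint \<Phi> * \<Phi>)) * (mat_adjoint \<Phi> * mat_diag n lam * \<Phi>)"
  shows "C \<in> carrier_mat m m"
    and "poly (char_poly C) x * det (weighted_gram (\<lambda>_. 1) E) = det (weighted_gram (\<lambda>l. x - lam l) E)"
proof -
  have \<Phi>c: "\<Phi> \<in> carrier_mat n m" using E U \<Phi> by simp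
  let ?M = "weighted_gram (\<lambda>_. 1) \<Phi>" and ?K = "weighted_gram lam \<Phi>"
  have M: "?M \<in> carrier_mat m m" and K: "?K \<in> carrier_mat m m"
    using weighted_gram_carrier[OF \<Phi>c] by auto
  have Us: "mat_adjoint U \<in> carrier_mat m m" and Vs: "mat_adjoint V \<in> carrier_mat m m" using U V by auto
  have "det U * det V = 1" using det_mult[OF U V] UV by simp
  then have dU: "det U \<noteq> 0" by auto
  \<comment> \<open>Taking adjoints in \<open>U * V = 1\<^sub>m m\<close> shows that
    \<open>mat_adjoint U\<close> is invertible without evaluating its determinant.\<close>
  have "mat_adjoint V * mat_adjoint U = 1\<^sub>m m" using mat_adjoint_mult[OF U V] UV by simp
  then have "det (mat_adjoint V) * det (mat_adjoint U) = 1" using det_mult[OF Vs Us] by simp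
  then have dUs: "det (mat_adjoint U) \<noteq> 0" by auto
  have det_gram: "det (weighted_gram f \<Phi>) = det (mat_adjoint U) * det (weighted_gram f E) * det U" for f
    unfolding \<Phi> weighted_gram_mult[OF E U]
    using det_mult[OF mult_carrier_mat[OF Us weighted_gram_carrier[OF E]] U] det_mult[OF Us weighted_gram_carrier[OF E]]
    by simp
  have dM: "det ?M \<noteq> 0" unfolding det_gram using dU dUs G0 by simp
  obtain Mi where Mi: "mat_inverse ?M = Some Mi"
    using mat_inverse(1)[OF M, of "()"] det_non_zero_imp_unit[OF M dM, of "()"]
    by (cases "mat_inverse ?M") auto
  have Mic: "Mi \<in> carrier_mat m m" and MMi: "?M * Mi = 1\<^sub>m m"
    using mat_inverse(2)[OF M Mi] by auto
  have C: "C = Mi * ?K"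
    unfolding C_def using Mi weighted_gram_one[OF \<Phi>c] \<Phi>c by (simp add: weighted_gram_def)
  show Cc: "C \<in> carrier_mat m m" unfolding C using Mic K by simp
  have MC: "?M * C = ?K"
    unfolding C using assoc_mult_mat[OF M Mic K] MMi K by simp
  have "det ?M * poly (char_poly C) x = det (?M * (- char_matrix C x))"
    unfolding char_poly_matrix[OF Cc] using Cc by (intro det_mult[OF M, symmetric]) simp
  also have "- char_matrix C x = x \<cdot>\<^sub>m 1\<^sub>m m - C"
    unfolding char_matrix_def using Cc by (intro eq_matI) auto
  also have "?M * (x \<cdot>\<^sub>m 1\<^sub>m m - C) = ?M * (x \<cdot>\<^sub>m 1\<^sub>m m) - ?M * C"
    by (rule mult_minus_distrib_mat[OF M _ Cc]) simp
  also have "\<dots> = weighted_gram (\<lambda>l. x - lam l) \<Phi>"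
    unfolding MC weighted_gram_diff[OF \<Phi>c] mult_smult_distrib[OF M one_carrier_mat]
      right_mult_one_mat[OF M] ..
  finally have "det ?M * poly (char_poly C) x = det (weighted_gram (\<lambda>l. x - lam l) \<Phi>)" .
  then show "poly (char_poly C) x * det (weighted_gram (\<lambda>_. 1) E) = det (weighted_gram (\<lambda>l. x - lam l) E)"
    unfolding det_gram using dU dUs by (simp add: mult_ac)
qed

text \<open>Identity block on top of \<open>B\<close>: its columns span the graph of
  \<open>B\<close>. The rows of \<open>B\<close> are numbered as rows of the whole matrix, from
  \<open>m\<close> on.\<close>

definition graph_mat :: "nat \<Rightarrow> nat \<Rightarrow> (nat \<Rightarrow> nat \<Rightarrow> 'a::field) \<Rightarrow> 'a mat" where
  "graph_mat n m B = mat n m (\<lambda>(i, j). if i < m then (if i = j then 1 else 0) else B i j)"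

lemma graph_mat_carrier [simp]: "graph_mat n m B \<in> carrier_mat n m"
  by (simp add: graph_mat_def)

lemma dim_graph_mat [simp]: "dim_row (graph_mat n m B) = n" "dim_col (graph_mat n m B) = m"
  by (simp_all add: graph_mat_def)

lemma graph_mat_index:
  "i < n \<Longrightarrow> j < m \<Longrightarrow>
    graph_mat n m B $$ (i, j) = (if i < m then (if i = j then 1 else 0) else B i j)"
  by (simp add: graph_mat_def)

text \<open>As \<open>B\<close> vanishes, the graph matrix tends to the identity block above zeros,
  and the weighted Gram matrix to the diagonal matrix of the first \<open>m\<close> weights. By
  \<open>norm_conj\<close> conjugation is isometric, so the conjugated entries vanish too.\<close>

lemma tendsto_det_weighted_gram_graph_mat:
  fixes B :: "'b \<Rightarrow> nat \<Rightarrow> nat \<Rightarrow> 'a::{real_normed_field, conjugatable_field}"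
  assumes norm_conj: "\<And>x::'a. norm (conjugate x) = norm x" and "m < n"
    and B: "\<And>l i. m \<le> l \<Longrightarrow> l < n \<Longrightarrow> i < m \<Longrightarrow> ((\<lambda>k. B k l i) \<longlongrightarrow> 0) F"
  shows "((\<lambda>k. det (weighted_gram f (graph_mat n m (B k)))) \<longlongrightarrow> (\<Prod>i<m. f i)) F"
proof -
  let ?E = "\<lambda>k. graph_mat n m (B k)"
  let ?\<delta> = "\<lambda>l i. if l = i then 1 else 0 :: 'a"
  have E: "((\<lambda>k. ?E k $$ (l, i)) \<longlongrightarrow> ?\<delta> l i) F" if "l < n" "i < m" for l i
    using that B[of l i] by (cases "l < m") (simp_all add: graph_mat_index)
  have cE: "((\<lambda>k. conjugate (?E k $$ (l, i))) \<longlongrightarrow> ?\<delta> l i) F" if "l < n" "i < m" for l i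
  proof (cases "l < m")
    case True
    then show ?thesis using that by (simp add: graph_mat_index)
  next
    case False
    have "((\<lambda>k. conjugate (B k l i)) \<longlongrightarrow> 0) F"
      using B[of l i] False that norm_conj
      by (subst tendsto_norm_zero_iff[symmetric]) (simp add: tendsto_norm_zero)
    then show ?thesis using that False by (simp add: graph_mat_index)
  qed
  have "((\<lambda>k. det (weighted_gram f (?E k))) \<longlongrightarrow> det (mat_diag m f)) F"
  proof (rule tendsto_det)
    fix i j assume ij: "i < m" "j < m"
    have "((\<lambda>k. \<Sum>l<n. conjugate (?E k $$ (l, i)) * f l * ?E k $$ (l, j)) \<longlongrightarrow>
        (\<Sum>l<n. ?\<delta> l i * f l * ?\<delta> l j)) F"
      using E cE ij by (intro tendsto_intros) auto
    also have "(\<Sum>l<n. ?\<delta> l i * f l * ?\<delta> l j) = (\<Sum>l<n. if l = i then f i * ?\<delta> i j else 0)"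
      by (intro sum.cong) auto
    also have "\<dots> = mat_diag m f $$ (i, j)"
      using ij \<open>m < n\<close> by (simp add: mat_diag_def)
    finally show "((\<lambda>k. weighted_gram f (?E k) $$ (i, j)) \<longlongrightarrow> mat_diag m f $$ (i, j)) F"
      using ij by (simp add: weighted_gram_index[OF graph_mat_carrier])
  qed (rule weighted_gram_carrier[OF graph_mat_carrier], simp)
  also have "det (mat_diag m f) = (\<Prod>i<m. f i)"
  proof -
    have "det (mat_diag m f) = prod_list (diag_mat (mat_diag m f))"
      by (rule det_upper_triangular[of _ m]) (auto simp: mat_diag_def)
    also have "diag_mat (mat_diag m f) = map f [0..<m]"
      by (auto simp: diag_mat_def mat_diag_def)
    finally show ?thesis by (simp add: prod.distinct_set_conv_list[symmetric] lessThan_atLeast0)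
  qed
  finally show ?thesis .
qed

text \<open>A Ritz pair is characterized by \<open>z\<close> lying in the subspace with a residual
  orthogonal to it, and neither condition depends on the basis. Membership in the graph gives the
  lower components; testing the residual against the graph basis gives the upper equations.\<close>

lemma ritz_pair_graph_mat:
  fixes B :: "nat \<Rightarrow> nat \<Rightarrow> 'a::conjugatable_field"
  assumes "m < n" and U: "U \<in> carrier_mat m m" and V: "V \<in> carrier_mat m m" and UV: "U * V = 1\<^sub>m m"
    and ritz: "ritz_pair (mat_diag n lam) (graph_mat n m B * U) \<theta> z"
  shows "dim_vec z = n"
    and "\<And>l. l \<in> {m..<n} \<Longrightarrow> z $ l = (\<Sum>i<m. B l i * z $ i)"
    and "\<And>i. i < m \<Longrightarrow> (\<theta> - lam i) * z $ i = (\<Sum>l=m..<n. conjugate (B l i) * (lam l - \<theta>) * z $ l)"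
proof -
  let ?E = "graph_mat n m B" and ?D = "mat_diag n lam"
  have E: "?E \<in> carrier_mat n m" by simp
  let ?F = "?E * U"
  have F: "?F \<in> carrier_mat n m" using mult_carrier_mat[OF E U] .
  have D: "?D \<in> carrier_mat n n" by simp
  have Fs: "mat_adjoint ?F \<in> carrier_mat m n" using F by simp
  obtain y where y: "y \<in> carrier_vec m" "z = ?F *\<^sub>v y"
    and eq: "(mat_adjoint ?F * ?D * ?F) *\<^sub>v y = \<theta> \<cdot>\<^sub>v ((mat_adjoint ?F * ?F) *\<^sub>v y)"
    using ritz F unfolding ritz_pair_def by auto
  have z: "z \<in> carrier_vec n" using y F by auto
  show "dim_vec z = n" using z by simp
  have Uy: "U *\<^sub>v y \<in> carrier_vec m" using U y by simp
  have z_E: "z = ?E *\<^sub>v (U *\<^sub>v y)" using y assoc_mult_mat_vec[OF E U] by simp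
  have z_index: "z $ l = (\<Sum>i<m. ?E $$ (l, i) * (U *\<^sub>v y) $ i)" if "l < n" for l
    unfolding z_E by (rule mult_mat_vec_index_sum[OF E Uy that])
  \<comment> \<open>Because of the identity block, the coordinates of \<open>z\<close> in the graph
    basis are its own first \<open>m\<close> entries.\<close>
  have z_top: "z $ i = (U *\<^sub>v y) $ i" if "i < m" for i
  proof -
    have "z $ i = (\<Sum>i'<m. if i = i' then (U *\<^sub>v y) $ i' else 0)"
      unfolding z_index[OF less_trans[OF that \<open>m < n\<close>]]
      using that \<open>m < n\<close> by (intro sum.cong) (auto simp: graph_mat_index)
    then show ?thesis using that by simp
  qed
  show "z $ l = (\<Sum>i<m. B l i * z $ i)" if "l \<in> {m..<n}" for l
    using that by (subst z_index) (auto simp: graph_mat_index z_top intro!: sum.cong)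
  have lhs: "(mat_adjoint ?F * ?D * ?F) *\<^sub>v y = mat_adjoint ?F *\<^sub>v (?D *\<^sub>v z)"
    unfolding y(2) assoc_mult_mat_vec[OF mult_carrier_mat[OF Fs D] F y(1)]
    by (rule assoc_mult_mat_vec[OF Fs D mult_mat_vec_carrier[OF F y(1)]])
  have rhs: "(mat_adjoint ?F * ?F) *\<^sub>v y = mat_adjoint ?F *\<^sub>v z"
    unfolding y(2) by (rule assoc_mult_mat_vec[OF Fs F y(1)])
  \<comment> \<open>Multiplying the Ritz equation by \<open>mat_adjoint V\<close> replaces the test
    basis \<open>?F\<close> by the graph basis \<open>?E\<close>.\<close>
  have "?E = ?F * V" using assoc_mult_mat[OF E U V] UV right_mult_one_mat[OF E] by simp
  then have Es: "mat_adjoint ?E = mat_adjoint V * mat_adjoint ?F"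
    using mat_adjoint_mult[OF F V] by simp
  have Vs: "mat_adjoint V \<in> carrier_mat m m" using V by simp
  have Dz: "?D *\<^sub>v z \<in> carrier_vec n" by (rule mult_mat_vec_carrier[OF D z])
  have "mat_adjoint ?E *\<^sub>v (?D *\<^sub>v z) = mat_adjoint V *\<^sub>v (mat_adjoint ?F *\<^sub>v (?D *\<^sub>v z))"
    unfolding Es by (rule assoc_mult_mat_vec[OF Vs Fs Dz])
  also have "\<dots> = mat_adjoint V *\<^sub>v (\<theta> \<cdot>\<^sub>v (mat_adjoint ?F *\<^sub>v z))"
    using eq unfolding lhs rhs by simp
  also have "\<dots> = \<theta> \<cdot>\<^sub>v (mat_adjoint V *\<^sub>v (mat_adjoint ?F *\<^sub>v z))"
    using Vs Fs z by (intro mult_mat_vec) auto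
  also have "mat_adjoint V *\<^sub>v (mat_adjoint ?F *\<^sub>v z) = mat_adjoint ?E *\<^sub>v z"
    unfolding Es by (rule assoc_mult_mat_vec[symmetric, OF Vs Fs z])
  finally have gal: "mat_adjoint ?E *\<^sub>v (?D *\<^sub>v z) = \<theta> \<cdot>\<^sub>v (mat_adjoint ?E *\<^sub>v z)" .
  have Estar: "mat_adjoint ?E \<in> carrier_mat m n" using E by simp
  have Dz_index: "(?D *\<^sub>v z) $ l = lam l * z $ l" if "l < n" for l
  proof -
    have "(?D *\<^sub>v z) $ l = (\<Sum>l'<n. if l = l' then lam l' * z $ l' else 0)"
      unfolding mult_mat_vec_index_sum[OF D z that]
      using that by (intro sum.cong) (auto simp: mat_diag_def)
    then show ?thesis using that by simp
  qed
  have adj_index: "(mat_adjoint ?E *\<^sub>v v) $ i = v $ i + (\<Sum>l=m..<n. conjugate (B l i) * v $ l)"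
    if i: "i < m" and v: "v \<in> carrier_vec n" for i v
  proof -
    have "(mat_adjoint ?E *\<^sub>v v) $ i = (\<Sum>l<n. mat_adjoint ?E $$ (i, l) * v $ l)"
      by (rule mult_mat_vec_index_sum[OF Estar v i])
    also have "\<dots> = (\<Sum>l<n. conjugate (?E $$ (l, i)) * v $ l)"
      using i by (intro sum.cong) (simp_all add: mat_adjoint_index[OF E])
    also have "\<dots> = (\<Sum>l<m. conjugate (?E $$ (l, i)) * v $ l) + (\<Sum>l=m..<n. conjugate (?E $$ (l, i)) * v $ l)"
      using \<open>m < n\<close> by (subst sum.union_disjoint[symmetric]) (auto intro!: sum.cong)
    also have "(\<Sum>l<m. conjugate (?E $$ (l, i)) * v $ l) = (\<Sum>l<m. if l = i then v $ l else 0)"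
      using i \<open>m < n\<close> by (intro sum.cong) (auto simp: graph_mat_index)
    also have "\<dots> = v $ i" using i by simp
    also have "(\<Sum>l=m..<n. conjugate (?E $$ (l, i)) * v $ l) = (\<Sum>l=m..<n. conjugate (B l i) * v $ l)"
      using i by (intro sum.cong) (auto simp: graph_mat_index)
    finally show ?thesis .
  qed
  fix i assume i: "i < m"
  have "(mat_adjoint ?E *\<^sub>v (?D *\<^sub>v z)) $ i = \<theta> * (mat_adjoint ?E *\<^sub>v z) $ i"
    unfolding gal using i Estar by simp
  then have "lam i * z $ i + (\<Sum>l=m..<n. conjugate (B l i) * (lam l * z $ l)) =
      \<theta> * (z $ i + (\<Sum>l=m..<n. conjugate (B l i) * z $ l))"
    using i \<open>m < n\<close> by (simp add: adj_index[OF i Dz] adj_index[OF i z] Dz_index)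
  then show "(\<theta> - lam i) * z $ i = (\<Sum>l=m..<n. conjugate (B l i) * (lam l - \<theta>) * z $ l)"
    by (simp add: algebra_simps sum_distrib_left sum_subtractf)
qed

section \<open>From an arbitrary basis of the iterated subspace to the graph basis\<close>

lemma col_space_subset_factor:
  fixes \<Phi> :: "'a::field mat"
  assumes \<Phi>: "\<Phi> \<in> carrier_mat n r" and Y: "Y \<in> carrier_mat n m"
    and sub: "vec_space.col_space n \<Phi> \<subseteq> vec_space.col_space n Y"
  shows "\<exists>U \<in> carrier_mat m r. \<Phi> = Y * U"
proof -
  interpret vec_space "TYPE('a)" n .
  \<comment> \<open>Each column of \<open>\<Phi>\<close> is the image of a unit vector, hence lies
    in the column space of \<open>Y\<close>; the coefficient vectors become the columns of the
    factor.\<close>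
  have "\<exists>u \<in> carrier_vec m. Y *\<^sub>v u = col \<Phi> j" if "j < r" for j
  proof -
    have "\<Phi> *\<^sub>v unit_vec r j = col \<Phi> j"
      using \<Phi> that by (intro eq_vecI) (auto simp: scalar_prod_right_unit)
    then have "col \<Phi> j \<in> col_space \<Phi>"
      using \<Phi> that unfolding col_space_eq[OF \<Phi>] by (auto intro!: bexI[of _ "unit_vec r j"])
    then show ?thesis using sub Y unfolding col_space_eq[OF Y] by auto
  qed
  then obtain u where u: "\<And>j. j < r \<Longrightarrow> u j \<in> carrier_vec m \<and> Y *\<^sub>v u j = col \<Phi> j" by metis
  let ?U = "mat m r (\<lambda>(i, j). u j $ i)"
  have "\<Phi> = Y * ?U"
  proof (rule eq_matI)
    fix i j assume ij: "i < dim_row (Y * ?U)" "j < dim_col (Y * ?U)"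
    then have i: "i < n" and j: "j < r" using Y by auto
    have "col ?U j = u j" using u[OF j] j by (intro eq_vecI) auto
    then have "(Y * ?U) $$ (i, j) = (Y *\<^sub>v u j) $ i" using i j Y by simp
    also have "\<dots> = \<Phi> $$ (i, j)" using u[OF j] i j \<Phi> by simp
    finally show "\<Phi> $$ (i, j) = (Y * ?U) $$ (i, j)" ..
  qed (use \<Phi> Y in auto)
  then show ?thesis by (intro bexI[of _ ?U]) auto
qed

lemma graph_mat_mult_index:
  assumes Z: "Z \<in> carrier_mat m r" and "m \<le> n" and l: "l < n" and j: "j < r"
  shows "(graph_mat n m B * Z) $$ (l, j) =
    (if l < m then Z $$ (l, j) else \<Sum>i<m. B l i * Z $$ (i, j))"
proof -
  have "(graph_mat n m B * Z) $$ (l, j) = (\<Sum>i<m. graph_mat n m B $$ (l, i) * Z $$ (i, j))"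
    by (rule mult_mat_index_sum[OF graph_mat_carrier Z l j])
  also have "\<dots> = (\<Sum>i<m. if l < m then (if l = i then Z $$ (i, j) else 0) else B l i * Z $$ (i, j))"
    using l by (intro sum.cong) (auto simp: graph_mat_index)
  finally show ?thesis by simp
qed

text \<open>The first \<open>m\<close> rows of the product are \<open>Z\<close> itself, and those of
  the graph matrix form the identity.\<close>

lemma graph_mat_mult_cancel:
  assumes Z: "Z \<in> carrier_mat m m" and "m \<le> n" and eq: "graph_mat n m B * Z = graph_mat n m B"
  shows "Z = 1\<^sub>m m"
proof (rule eq_matI)
  fix i j assume "i < dim_row (1\<^sub>m m :: 'a mat)" "j < dim_col (1\<^sub>m m :: 'a mat)"
  then have ij: "i < m" "j < m" by auto
  then have "Z $$ (i, j) = (graph_mat n m B * Z) $$ (i, j)"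
    using graph_mat_mult_index[OF Z \<open>m \<le> n\<close>, of i j] \<open>m \<le> n\<close> by simp
  then show "Z $$ (i, j) = 1\<^sub>m m $$ (i, j)"
    using ij \<open>m \<le> n\<close> by (simp add: eq graph_mat_index)
qed (use Z in auto)

lemma pow_mat_diag: "mat_diag n f ^\<^sub>m k = mat_diag n (\<lambda>i. f i ^ k)"
proof (induction k)
  case 0
  show ?case by (simp add: mat_diag_def)
next
  case (Suc k)
  then show ?case by (simp only: pow_mat.simps mat_diag_diag power_Suc2)
qed

lemma submatrix_rows_lessThan:
  assumes X: "X \<in> carrier_mat n r" and "m \<le> n"
  shows "submatrix X {..<m} UNIV \<in> carrier_mat m r"
    and "\<And>i j. i < m \<Longrightarrow> j < r \<Longrightarrow> submatrix X {..<m} UNIV $$ (i, j) = X $$ (i, j)"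
proof -
  have c: "{i. i < dim_row X \<and> i \<in> {..<m}} = {..<m}" "{j. j < dim_col X \<and> j \<in> UNIV} = {..<r}"
    using X \<open>m \<le> n\<close> by auto
  show "submatrix X {..<m} UNIV \<in> carrier_mat m r"
    unfolding carrier_mat_def by (simp only: mem_Collect_eq dim_submatrix c card_lessThan)
  fix i j assume ij: "i < m" "j < r"
  have "{a \<in> {..<m}. a < i} = {..<i}" using ij by auto
  then have "pick {..<m} i = i" using pick_card_in_set[of i "{..<m}"] ij by simp
  then show "submatrix X {..<m} UNIV $$ (i, j) = X $$ (i, j)"
    using submatrix_index[of i X "{..<m}" j UNIV] ij by (simp only: c card_lessThan pick_UNIV)
qed

lemma submatrix_rows_atLeastLessThan:
  assumes X: "X \<in> carrier_mat n r"
  shows "submatrix X {m..<n} UNIV \<in> carrier_mat (n - m) r"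
    and "\<And>i j. i < n - m \<Longrightarrow> j < r \<Longrightarrow> submatrix X {m..<n} UNIV $$ (i, j) = X $$ (m + i, j)"
proof -
  have c: "{i. i < dim_row X \<and> i \<in> {m..<n}} = {m..<n}" "{j. j < dim_col X \<and> j \<in> UNIV} = {..<r}"
    using X by auto
  show "submatrix X {m..<n} UNIV \<in> carrier_mat (n - m) r"
    unfolding carrier_mat_def by (simp only: mem_Collect_eq dim_submatrix c card_lessThan card_atLeastLessThan)
  fix i j assume ij: "i < n - m" "j < r"
  \<comment> \<open>\<open>pick\<close> counts the selected rows preceding a given one, so row
    \<open>i\<close> of the lower block is row \<open>m + i\<close> of \<open>X\<close>. This shift
    is why entries of \<open>W\<close> are later read at \<open>l - m\<close>.\<close>
  have "{a \<in> {m..<n}. a < m + i} = {m..<m + i}" using ij by auto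
  then have "pick {m..<n} i = m + i" using pick_card_in_set[of "m + i" "{m..<n}"] ij by simp
  then show "submatrix X {m..<n} UNIV $$ (i, j) = X $$ (m + i, j)"
    using submatrix_index[of i X "{m..<n}" j UNIV] ij
    by (simp only: c card_lessThan card_atLeastLessThan pick_UNIV)
qed

text \<open>Connects two notions of inverse: an abstract two-sided inverse makes \<open>A\<close> a
  unit of the matrix ring, and on units \<open>mat_inverse\<close> returns a result.\<close>

lemma invertible_mat_the_inverse:
  fixes A :: "'a::field mat"
  assumes A: "A \<in> carrier_mat m m" and inv: "invertible_mat A"
  shows "the (mat_inverse A) \<in> carrier_mat m m" "A * the (mat_inverse A) = 1\<^sub>m m"
    "the (mat_inverse A) * A = 1\<^sub>m m"
proof -
  obtain A' where A': "A * A' = 1\<^sub>m m" "A' * A = 1\<^sub>m (dim_row A')"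
    using inv A unfolding invertible_mat_def inverts_mat_def by auto
  \<comment> \<open>The dimensions of the witness are read off from those of the two identity
    matrices.\<close>
  have A'c: "A' \<in> carrier_mat m m"
    using A arg_cong[OF A'(1), of dim_col] arg_cong[OF A'(2), of dim_col] by auto
  then have "A \<in> Units (ring_mat TYPE('a) m ())"
    using A A' unfolding Units_def ring_mat_def by auto
  then obtain C where C: "mat_inverse A = Some C"
    using mat_inverse(1)[OF A, of "()"] by (cases "mat_inverse A") auto
  then show "the (mat_inverse A) \<in> carrier_mat m m" "A * the (mat_inverse A) = 1\<^sub>m m"
    "the (mat_inverse A) * A = 1\<^sub>m m"
    using mat_inverse(2)[OF A C] by auto
qed

text \<open>Writing \<open>X1\<close> and \<open>X2\<close> for the upper and lower blocks of
  \<open>X\<close>, the identity \<open>W * X1 = X2\<close> shows that the iterated matrix is the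
  graph matrix times its own invertible upper block. A matrix \<open>\<Phi>\<close> with the same
  column space then differs from the graph basis by an invertible factor.\<close>

lemma krylov_basis_factor:
  fixes n m :: nat and X :: "'a::field mat" and lam :: "nat \<Rightarrow> 'a"
  defines "W \<equiv> submatrix X {m..<n} UNIV * the (mat_inverse (submatrix X {..<m} UNIV))"
  assumes X: "X \<in> carrier_mat n m" and "m \<le> n" and inv: "invertible_mat (submatrix X {..<m} UNIV)"
    and lam: "\<And>i. i < m \<Longrightarrow> lam i \<noteq> 0" and \<Phi>: "\<Phi> \<in> carrier_mat n m"
    and col: "vec_space.col_space n \<Phi> = vec_space.col_space n (mat_diag n lam ^\<^sub>m k * X)"
  shows "\<exists>U \<in> carrier_mat m m. \<exists>V \<in> carrier_mat m m.
    \<Phi> = graph_mat n m (\<lambda>l i. W $$ (l - m, i) * (lam l ^ k / lam i ^ k)) * U \<and> U * V = 1\<^sub>m m"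
proof -
  let ?B = "\<lambda>l i. W $$ (l - m, i) * (lam l ^ k / lam i ^ k)"
  let ?E = "graph_mat n m ?B"
  let ?X1 = "submatrix X {..<m} UNIV" and ?X2 = "submatrix X {m..<n} UNIV"
  note X1 = submatrix_rows_lessThan[OF X \<open>m \<le> n\<close>] and X2 = submatrix_rows_atLeastLessThan[where m = m, OF X]
  let ?X1i = "the (mat_inverse ?X1)"
  note X1i = invertible_mat_the_inverse[OF X1(1) inv]
  define Y where "Y = mat_diag n (\<lambda>i. lam i ^ k) * X"
  have Y: "Y \<in> carrier_mat n m" unfolding Y_def by (rule mult_carrier_mat[OF mat_diag_dim X])
  have Y_index: "Y $$ (l, j) = lam l ^ k * X $$ (l, j)" if "l < n" "j < m" for l j
    using that by (simp add: Y_def mat_diag_mult_left[OF X])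
  have E: "?E \<in> carrier_mat n m" by simp
  have WX1: "W * ?X1 = ?X2"
    unfolding W_def using assoc_mult_mat[OF X2(1) X1i(1) X1(1)] X1i(3) X2(1) by simp
  have Wc: "W \<in> carrier_mat (n - m) m" unfolding W_def by (rule mult_carrier_mat[OF X2(1) X1i(1)])
  \<comment> \<open>\<open>P\<close> is the upper block of the iterated matrix \<open>Y\<close>, and
    \<open>Q\<close> is its inverse.\<close>
  define P where "P = mat_diag m (\<lambda>i. lam i ^ k) * ?X1"
  define Q where "Q = ?X1i * mat_diag m (\<lambda>i. inverse (lam i ^ k))"
  have P: "P \<in> carrier_mat m m" unfolding P_def by (rule mult_carrier_mat[OF mat_diag_dim X1(1)])
  have Q: "Q \<in> carrier_mat m m" unfolding Q_def by (rule mult_carrier_mat[OF X1i(1) mat_diag_dim])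
  have P_index: "P $$ (i, j) = lam i ^ k * ?X1 $$ (i, j)" if "i < m" "j < m" for i j
    using that by (simp add: P_def mat_diag_mult_left[OF X1(1)])
  have "P * Q = mat_diag m (\<lambda>i. lam i ^ k) * (?X1 * Q)"
    unfolding P_def by (rule assoc_mult_mat[OF mat_diag_dim X1(1) Q])
  also have "?X1 * Q = mat_diag m (\<lambda>i. inverse (lam i ^ k))"
    unfolding Q_def assoc_mult_mat[OF X1(1) X1i(1) mat_diag_dim, symmetric] X1i(2)
    by (rule left_mult_one_mat[OF mat_diag_dim])
  also have "mat_diag m (\<lambda>i. lam i ^ k) * \<dots> = 1\<^sub>m m"
    unfolding mat_diag_diag mat_diag_one[symmetric] using lam
    by (auto simp: mat_diag_def simp del: mat_diag_one intro!: eq_matI)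
  finally have PQ: "P * Q = 1\<^sub>m m" .
  have Y_EP: "Y = ?E * P"
  proof (rule eq_matI)
    fix l j assume "l < dim_row (?E * P)" "j < dim_col (?E * P)"
    then have l: "l < n" and j: "j < m" using P by auto
    show "Y $$ (l, j) = (?E * P) $$ (l, j)"
    proof (cases "l < m")
      case True
      then show ?thesis using l j \<open>m \<le> n\<close>
        by (simp add: graph_mat_mult_index[OF P] Y_index P_index X1(2))
    next
      case False
      then have l': "l - m < n - m" using l by simp
      have "(?E * P) $$ (l, j) = (\<Sum>i<m. ?B l i * P $$ (i, j))"
        using False l j \<open>m \<le> n\<close> by (simp add: graph_mat_mult_index[OF P])
      also have "\<dots> = lam l ^ k * (\<Sum>i<m. W $$ (l - m, i) * ?X1 $$ (i, j))"
        unfolding sum_distrib_left using lam j by (intro sum.cong) (auto simp: P_index)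
      also have "(\<Sum>i<m. W $$ (l - m, i) * ?X1 $$ (i, j)) = (W * ?X1) $$ (l - m, j)"
        by (rule mult_mat_index_sum[OF Wc X1(1) l' j, symmetric])
      also have "\<dots> = X $$ (l, j)"
        unfolding WX1 using X2(2)[OF l' j] False by simp
      finally show ?thesis using l j by (simp add: Y_index)
    qed
  qed (use Y E P in auto)
  have col': "vec_space.col_space n \<Phi> = vec_space.col_space n Y"
    using col unfolding Y_def pow_mat_diag .
  obtain U0 where U0: "U0 \<in> carrier_mat m m" "\<Phi> = Y * U0"
    using col_space_subset_factor[OF \<Phi> Y] col' by auto
  obtain V0 where V0: "V0 \<in> carrier_mat m m" "Y = \<Phi> * V0"
    using col_space_subset_factor[OF Y \<Phi>] col' by auto
  have U: "P * U0 \<in> carrier_mat m m" and V: "V0 * Q \<in> carrier_mat m m" using mult_carrier_mat[OF P U0(1)] mult_carrier_mat[OF V0(1) Q] by auto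
  have \<Phi>_E: "\<Phi> = ?E * (P * U0)"
    unfolding U0(2) Y_EP by (rule assoc_mult_mat[OF E P U0(1)])
  \<comment> \<open>Going from the graph basis to \<open>\<Phi>\<close> and back through
    \<open>Y\<close> fixes the graph matrix, and cancelling it leaves the identity.\<close>
  have "?E * ((P * U0) * (V0 * Q)) = ?E * (P * U0) * (V0 * Q)"
    by (rule assoc_mult_mat[symmetric, OF E U V])
  also have "\<dots> = \<Phi> * V0 * Q"
    unfolding \<Phi>_E[symmetric] by (rule assoc_mult_mat[symmetric, OF \<Phi> V0(1) Q])
  also have "\<dots> = ?E * (P * Q)"
    unfolding V0(2)[symmetric] Y_EP by (rule assoc_mult_mat[OF E P Q])
  also have "\<dots> = ?E" unfolding PQ by simp
  finally have "(P * U0) * (V0 * Q) = 1\<^sub>m m"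
    by (rule graph_mat_mult_cancel[OF mult_carrier_mat[OF U V] \<open>m \<le> n\<close>])
  then show ?thesis using U V \<Phi>_E by blast
qed

section \<open>Asymptotics of the Ritz pairs\<close>

lemma finite_pos_lower_bound:
  fixes f :: "'b \<Rightarrow> real"
  assumes "finite A" and "\<And>x. x \<in> A \<Longrightarrow> 0 < f x"
  shows "\<exists>c>0. \<forall>x\<in>A. c \<le> f x"
proof (cases "A = {}")
  case False
  then show ?thesis using assms by (intro exI[of _ "Min (f ` A)"]) simp
qed (auto intro: exI[of _ 1])

text \<open>One argument serves both fields: \<open>roots\<close> and \<open>norm_conj\<close>
  isolate what has to be supplied for each, namely localization of roots within the field and
  invariance of the norm under conjugation.\<close>

lemma ritz_asymptotics:
  fixes n m :: nat and lam :: "nat \<Rightarrow> 'a::{real_normed_field, conjugatable_field}" and X :: "'a mat"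
  defines "W \<equiv> submatrix X {m..<n} UNIV * the (mat_inverse (submatrix X {..<m} UNIV))"
  assumes norm_conj: "\<And>x::'a. norm (conjugate x) = norm x"
    and roots: "\<And>(p::'a poly) c \<epsilon>. lead_coeff p = 1 \<Longrightarrow> degree p = m \<Longrightarrow> 0 \<le> \<epsilon> \<Longrightarrow>
      (\<And>i j. i < j \<Longrightarrow> j < m \<Longrightarrow> 2 * \<epsilon> \<le> norm (c i - c j)) \<Longrightarrow>
      (\<And>j. j < m \<Longrightarrow> norm (poly p (c j)) < \<epsilon> ^ m) \<Longrightarrow>
      \<exists>\<theta>. proots p = mset (map \<theta> [0..<m]) \<and> (\<forall>j<m. norm (\<theta> j - c j) < \<epsilon>)"
    and m0: "0 < m" and mn: "m < n"
    and dec: "\<forall>i j. i < j \<and> j < n \<longrightarrow> norm (lam j) < norm (lam i)"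
    and pos: "\<forall>i<n. 0 < norm (lam i)"
    and X: "X \<in> carrier_mat n m" and inv: "invertible_mat (submatrix X {..<m} UNIV)"
    and nz: "\<forall>i<n - m. \<forall>j<m. W $$ (i, j) \<noteq> 0"
  shows "\<exists>M6 M7 :: real. \<exists>k7 :: nat. 0 < M6 \<and> 0 < M7 \<and> 0 < k7 \<and>
       (\<forall>k\<ge>k7. \<forall>\<Phi>.
          basis_matrix n m \<Phi> (vec_space.col_space n (mat_diag n lam ^\<^sub>m k * X)) \<longrightarrow>
          (\<exists>\<theta> :: nat \<Rightarrow> 'a.
             ritz_values (mat_diag n lam) \<Phi> = mset (map \<theta> [0..<m]) \<and>
             (\<forall>i j. i < j \<and> j < m \<longrightarrow> norm (\<theta> j) < norm (\<theta> i)) \<and>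
             (\<forall>j<m. \<forall>z. ritz_pair (mat_diag n lam) \<Phi> (\<theta> j) z \<and> euclidean_norm z = 1 \<longrightarrow>
                (\<forall>i<m. i \<noteq> j \<longrightarrow>
                   M7 * (norm (lam m) ^ (2 * k) / (norm (lam i) ^ k * norm (lam j) ^ k)) \<le> norm (z $ i) \<and>
                   norm (z $ i) \<le> M6 * (norm (lam m) ^ (2 * k) / (norm (lam i) ^ k * norm (lam j) ^ k))) \<and>
                (\<forall>i. m \<le> i \<and> i < n \<longrightarrow>
                   M7 * (norm (lam i) ^ k / norm (lam j) ^ k) \<le> norm (z $ i) \<and>
                   norm (z $ i) \<le> M6 * (norm (lam i) ^ k / norm (lam j) ^ k)) \<and>
                M7 * (norm (lam m) ^ (2 * k) / norm (lam j) ^ (2 * k)) \<le> 1 - norm (z $ j) \<and>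
                1 - norm (z $ j) \<le> M6 * (norm (lam m) ^ (2 * k) / norm (lam j) ^ (2 * k)))))"
proof -
  \<comment> \<open>Inserting \<open>lam m\<close> splits the ratio of \<open>lam l\<close> to
    \<open>lam i\<close> into \<open>b\<close>, which depends on the row only, and \<open>a\<close>,
    which depends on the column only.\<close>
  define w where "w l i = norm (W $$ (l - m, i))" for l i
  define a where "a k i = (norm (lam m) / norm (lam i)) ^ k" for k i
  define b where "b k l = (norm (lam l) / norm (lam m)) ^ k" for k l
  define B where "B k l i = W $$ (l - m, i) * (lam l ^ k / lam i ^ k)" for k l i
  define s where "s k = (\<Sum>i<m. (a k i)\<^sup>2) + (\<Sum>l\<in>{m<..<n}. (b k l)\<^sup>2)" for k
  let ?E = "\<lambda>k. graph_mat n m (B k)"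
  have lam_m: "0 < norm (lam m)" using pos mn by blast
  have pos': "0 < norm (lam i)" if "i < n" for i using pos that by blast

  \<comment> \<open>Constants independent of \<open>k\<close>\<close>
  let ?P = "{m..<n} \<times> {..<m}"
  have "\<exists>c>0. \<forall>x\<in>?P. c \<le> (\<lambda>(l, i). w l i) x"
  proof (rule finite_pos_lower_bound)
    fix x assume "x \<in> ?P"
    then obtain l i where "x = (l, i)" "l - m < n - m" "i < m" by force
    then show "0 < (\<lambda>(l, i). w l i) x" using nz by (simp add: w_def)
  qed simp
  then obtain w\<^sub>0 where w0: "0 < w\<^sub>0" "\<And>l i. l \<in> {m..<n} \<Longrightarrow> i < m \<Longrightarrow> w\<^sub>0 \<le> w l i" by auto
  obtain Wb where Wb: "0 < Wb" "\<And>l i. l \<in> {m..<n} \<Longrightarrow> i < m \<Longrightarrow> w l i \<le> Wb"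
  proof
    show "0 < 1 + (\<Sum>(l, i)\<in>?P. w l i)"
      by (intro add_pos_nonneg sum_nonneg) (auto simp: w_def)
    fix l i assume "l \<in> {m..<n}" "i < m"
    then have "(\<lambda>(l, i). w l i) (l, i) \<le> (\<Sum>(l, i)\<in>?P. w l i)"
      by (intro member_le_sum) (auto simp: w_def)
    then show "w l i \<le> 1 + (\<Sum>(l, i)\<in>?P. w l i)" by simp
  qed
  let ?Q = "{(i, j). i < j \<and> j < n}"
  have "\<exists>c>0. \<forall>x\<in>?Q. c \<le> (\<lambda>(i, j). norm (lam i) - norm (lam j)) x"
  proof (rule finite_pos_lower_bound)
    show "finite ?Q" by (rule finite_subset[of _ "{..<n} \<times> {..<n}"]) auto
  qed (use dec in auto)
  then obtain c where c: "0 < c" "\<And>i j. i < j \<Longrightarrow> j < n \<Longrightarrow> c \<le> norm (lam i) - norm (lam j)" by auto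
  \<comment> \<open>Half the least gap between the moduli: discs of radius \<open>\<delta>\<close>
    are then disjoint, their points keep the order of the moduli, and each disc stays
    \<open>\<delta>\<close> away from all other diagonal entries.\<close>
  define \<delta> where "\<delta> = c / 2"
  have \<delta>: "0 < \<delta>" and gap_norm: "\<And>i j. i < j \<Longrightarrow> j < n \<Longrightarrow> 2 * \<delta> \<le> norm (lam i) - norm (lam j)"
    using c by (auto simp: \<delta>_def)
  have gap: "2 * \<delta> \<le> norm (lam i - lam j)" if "i < n" "j < n" "i \<noteq> j" for i j
    using that gap_norm[of i j] gap_norm[of j i] norm_triangle_ineq2[of "lam i" "lam j"]
      norm_triangle_ineq2[of "lam j" "lam i"]
    by (cases i j rule: linorder_cases) (auto simp: norm_minus_commute)
  \<comment> \<open>Bounds the distance from a point within \<open>\<delta>\<close> of one diagonal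
    entry to any other, since \<open>lam 0\<close> has the largest modulus.\<close>
  define T where "T = \<delta> + 2 * norm (lam 0)"
  have T0: "0 < T" using \<delta> by (simp add: T_def add_pos_nonneg)
  have lam_le: "norm (lam i) \<le> norm (lam 0)" if "i < n" for i
    using dec that by (cases "i = 0") (auto intro: less_imp_le)
  define D where "D = real n * Wb\<^sup>2 * T / \<delta>"
  have D0: "0 < D" using mn Wb(1) T0 \<delta> by (simp add: D_def)

  \<comment> \<open>Limits as \<open>k\<close> grows and the choice of the threshold\<close>
  have ratio_a: "norm (lam m) / norm (lam i) < 1" if "i < m" for i
    using dec that mn pos'[of i] by simp
  have ratio_b: "norm (lam l) / norm (lam m) < 1" if "m < l" "l < n" for l
    using dec that lam_m by simp
  have a_lim: "(\<lambda>k. a k i) \<longlonglongrightarrow> 0" if "i < m" for i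
    unfolding a_def using ratio_a[OF that] by (intro LIMSEQ_power_zero) simp
  have b_lim: "(\<lambda>k. b k l) \<longlonglongrightarrow> 0" if "m < l" "l < n" for l
    unfolding b_def using ratio_b[OF that] by (intro LIMSEQ_power_zero) simp
  have a01: "0 < a k i \<and> a k i \<le> 1" if "i < m" for k i
    unfolding a_def using ratio_a[OF that] lam_m pos'[of i] that mn
    by (auto intro!: zero_less_power power_le_one)
  have b01: "0 < b k l \<and> b k l \<le> 1" if "l \<in> {m..<n}" for k l
    unfolding b_def using ratio_b[of l] lam_m pos'[of l] that
    by (cases "l = m") (auto intro!: zero_less_power power_le_one)
  have bm: "b k m = 1" for k unfolding b_def using lam_m by simp
  have s_lim: "s \<longlonglongrightarrow> 0"
  proof -
    have "s \<longlonglongrightarrow> (\<Sum>i<m. 0\<^sup>2) + (\<Sum>l\<in>{m<..<n}. 0\<^sup>2)"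
      unfolding s_def using a_lim b_lim by (intro tendsto_intros) auto
    then show ?thesis by simp
  qed
  have small: "eventually (\<lambda>k. C * s k \<le> \<eta>) sequentially" if "0 < \<eta>" for C \<eta> :: real
  proof -
    have "(\<lambda>k. C * s k) \<longlonglongrightarrow> C * 0" by (intro tendsto_intros s_lim)
    then have "eventually (\<lambda>k. C * s k < \<eta>) sequentially" using that by (intro order_tendstoD(2)) auto
    then show ?thesis by eventually_elim simp
  qed
  have normB: "norm (B k l i) = w l i * b k l * a k i" if "l \<in> {m..<n}" "i < m" for k l i
  proof -
    have "b k l * a k i = norm (lam l) ^ k / norm (lam i) ^ k"
      unfolding a_def b_def using lam_m by (simp add: power_mult_distrib[symmetric] power_divide[symmetric])
    then show ?thesis by (simp add: B_def w_def norm_mult norm_divide norm_power mult.assoc)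
  qed
  have B_lim: "(\<lambda>k. B k l i) \<longlonglongrightarrow> 0" if "m \<le> l" "l < n" "i < m" for l i
  proof (rule tendsto_norm_zero_cancel, rule tendsto_sandwich[where f = "\<lambda>_. 0" and h = "\<lambda>k. Wb * a k i"])
    show "(\<lambda>k. Wb * a k i) \<longlonglongrightarrow> 0"
      using tendsto_mult_left[OF a_lim[OF that(3)], of Wb] by simp
    have l: "l \<in> {m..<n}" using that by simp
    have "norm (B k l i) \<le> Wb * a k i" for k
    proof -
      have "norm (B k l i) \<le> Wb * 1 * a k i"
        unfolding normB[OF l that(3)] using Wb(2)[OF l that(3)] b01[OF l, of k] a01[OF that(3), of k] Wb(1)
        by (intro mult_mono) (auto simp: w_def)
      then show ?thesis by simp
    qed
    then show "\<forall>\<^sub>F k in sequentially. norm (B k l i) \<le> Wb * a k i" by simp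
  qed auto
  have det_lim: "(\<lambda>k. det (weighted_gram f (?E k))) \<longlonglongrightarrow> (\<Prod>i<m. f i)" for f
    by (rule tendsto_det_weighted_gram_graph_mat[OF norm_conj mn B_lim])
  have det1: "(\<lambda>k. det (weighted_gram (\<lambda>_. 1) (?E k))) \<longlonglongrightarrow> 1" using det_lim[of "\<lambda>_. 1"] by simp
  have ev_det: "\<forall>\<^sub>F k in sequentially. det (weighted_gram (\<lambda>_. 1) (?E k)) \<noteq> 0"
    by (rule tendsto_imp_eventually_ne[OF det1]) simp
  have "\<forall>\<^sub>F k in sequentially. norm (det (weighted_gram (\<lambda>l. lam j - lam l) (?E k)) /
      det (weighted_gram (\<lambda>_. 1) (?E k))) < \<delta> ^ m" if "j < m" for j
  proof -
    \<comment> \<open>The factor \<open>i = j\<close> vanishes. The quotient below is the value at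
      \<open>lam j\<close> of the characteristic polynomial of the projected matrix, and
      \<open>\<delta> ^ m\<close> is the threshold under which \<open>roots\<close> applies.\<close>
    have "(\<Prod>i<m. lam j - lam i) = 0" using that by (intro prod_zero) auto
    then have "(\<lambda>k. det (weighted_gram (\<lambda>l. lam j - lam l) (?E k)) /
        det (weighted_gram (\<lambda>_. 1) (?E k))) \<longlonglongrightarrow> 0 / 1"
      using det_lim[of "\<lambda>l. lam j - lam l"] by (intro tendsto_divide det1) (simp_all only:, simp)
    then have "(\<lambda>k. norm (det (weighted_gram (\<lambda>l. lam j - lam l) (?E k)) /
        det (weighted_gram (\<lambda>_. 1) (?E k)))) \<longlonglongrightarrow> 0"
      using tendsto_norm_zero by force
    then show ?thesis using \<delta> by (intro order_tendstoD(2)) auto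
  qed
  then have ev_root: "\<forall>\<^sub>F k in sequentially. \<forall>j\<in>{..<m}. norm (det (weighted_gram (\<lambda>l. lam j - lam l) (?E k)) /
      det (weighted_gram (\<lambda>_. 1) (?E k))) < \<delta> ^ m"
    by (intro eventually_ball_finite) auto
  have "\<forall>\<^sub>F k in sequentially. D * s k \<le> 1 / 2 \<and> 4 * Wb * D * s k \<le> w\<^sub>0 \<and>
      8 * Wb\<^sup>2 * T * s k \<le> w\<^sub>0\<^sup>2 * \<delta> \<and> real n * (2 * (D + Wb))\<^sup>2 * s k \<le> 1 / 2"
    using w0(1) \<delta> by (intro eventually_conj small) auto
  from eventually_conj[OF this eventually_conj[OF ev_det ev_root]] obtain K where K:
    "\<And>k. K \<le> k \<Longrightarrow> D * s k \<le> 1 / 2 \<and> 4 * Wb * D * s k \<le> w\<^sub>0 \<and>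
      8 * Wb\<^sup>2 * T * s k \<le> w\<^sub>0\<^sup>2 * \<delta> \<and> real n * (2 * (D + Wb))\<^sup>2 * s k \<le> 1 / 2"
    "\<And>k. K \<le> k \<Longrightarrow> det (weighted_gram (\<lambda>_. 1) (?E k)) \<noteq> 0"
    "\<And>k j. K \<le> k \<Longrightarrow> j < m \<Longrightarrow> norm (det (weighted_gram (\<lambda>l. lam j - lam l) (?E k)) /
      det (weighted_gram (\<lambda>_. 1) (?E k))) < \<delta> ^ m"
    unfolding eventually_sequentially by auto

  \<comment> \<open>The sum dominates the three upper constants of
    \<open>ritz_vector_bounds\<close>; the minimum in \<open>M7\<close> lies below its three lower
    ones.\<close>
  define M6 where "M6 = 2 * D + 2 * Wb + real n * (2 * (D + Wb))\<^sup>2"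
  define M7 where "M7 = Min {w\<^sub>0\<^sup>2 * \<delta> / (8 * T), w\<^sub>0 / 4, w\<^sub>0\<^sup>2 / 32}"
  have M6: "2 * D \<le> M6" "2 * Wb \<le> M6" "real n * (2 * (D + Wb))\<^sup>2 \<le> M6"
    using D0 Wb(1) by (auto simp: M6_def)
  have M7: "M7 \<le> w\<^sub>0\<^sup>2 * \<delta> / (8 * T)" "M7 \<le> w\<^sub>0 / 4" "M7 \<le> w\<^sub>0\<^sup>2 / 32"
    unfolding M7_def by auto
  have M67_pos: "0 < M6" "0 < M7"
    using M6 D0 w0(1) \<delta> T0 by (auto simp: M7_def)
  show ?thesis
  \<comment> \<open>The successor makes the threshold positive.\<close>
  proof (rule exI[of _ M6], rule exI[of _ M7], rule exI[of _ "Suc K"], intro conjI M67_pos allI impI)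
    fix k \<Phi>
    assume "Suc K \<le> k" and basis: "basis_matrix n m \<Phi> (vec_space.col_space n (mat_diag n lam ^\<^sub>m k * X))"
    then have k: "K \<le> k" by simp
    have lam_nz: "lam i \<noteq> 0" if "i < m" for i using pos'[of i] that mn by auto
    obtain U V where U: "U \<in> carrier_mat m m" and V: "V \<in> carrier_mat m m"
      and UV: "U * V = 1\<^sub>m m" and \<Phi>: "\<Phi> = ?E k * U"
      using krylov_basis_factor[where lam = lam and \<Phi> = \<Phi> and k = k, OF X less_imp_le[OF mn] inv lam_nz] basis
      unfolding basis_matrix_def B_def W_def by auto
    define C where "C = the (mat_inverse (mat_adjoint \<Phi> * \<Phi>)) * (mat_adjoint \<Phi> * mat_diag n lam * \<Phi>)"
    note ritz_char = poly_char_poly_ritz[OF graph_mat_carrier U V UV K(2)[OF k] \<Phi>, of lam, folded C_def]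
    have "\<exists>\<theta>. proots (char_poly C) = mset (map \<theta> [0..<m]) \<and> (\<forall>j<m. norm (\<theta> j - lam j) < \<delta>)"
    proof (rule roots)
      show "lead_coeff (char_poly C) = 1" "degree (char_poly C) = m"
        using degree_monic_char_poly[OF ritz_char(1)] by auto
      fix j assume j: "j < m"
      show "norm (poly (char_poly C) (lam j)) < \<delta> ^ m"
        using K(3)[OF k j] ritz_char(2)[of "lam j", symmetric] K(2)[OF k] by simp
    qed (use \<delta> gap mn in auto)
    then obtain \<theta> where \<theta>: "proots (char_poly C) = mset (map \<theta> [0..<m])"
      and near: "\<And>j. j < m \<Longrightarrow> norm (\<theta> j - lam j) < \<delta>" by blast
    show "\<exists>\<theta>. ritz_values (mat_diag n lam) \<Phi> = mset (map \<theta> [0..<m]) \<and>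
             (\<forall>i j. i < j \<and> j < m \<longrightarrow> norm (\<theta> j) < norm (\<theta> i)) \<and>
             (\<forall>j<m. \<forall>z. ritz_pair (mat_diag n lam) \<Phi> (\<theta> j) z \<and> euclidean_norm z = 1 \<longrightarrow>
                (\<forall>i<m. i \<noteq> j \<longrightarrow>
                   M7 * (norm (lam m) ^ (2 * k) / (norm (lam i) ^ k * norm (lam j) ^ k)) \<le> norm (z $ i) \<and>
                   norm (z $ i) \<le> M6 * (norm (lam m) ^ (2 * k) / (norm (lam i) ^ k * norm (lam j) ^ k))) \<and>
                (\<forall>i. m \<le> i \<and> i < n \<longrightarrow>
                   M7 * (norm (lam i) ^ k / norm (lam j) ^ k) \<le> norm (z $ i) \<and>
                   norm (z $ i) \<le> M6 * (norm (lam i) ^ k / norm (lam j) ^ k)) \<and>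
                M7 * (norm (lam m) ^ (2 * k) / norm (lam j) ^ (2 * k)) \<le> 1 - norm (z $ j) \<and>
                1 - norm (z $ j) \<le> M6 * (norm (lam m) ^ (2 * k) / norm (lam j) ^ (2 * k)))"
    proof (rule exI[of _ \<theta>], intro conjI)
      show "ritz_values (mat_diag n lam) \<Phi> = mset (map \<theta> [0..<m])"
        unfolding ritz_values_def using \<theta> by (simp add: C_def)
      show "\<forall>i j. i < j \<and> j < m \<longrightarrow> norm (\<theta> j) < norm (\<theta> i)"
      proof (intro allI impI)
        fix i j assume ij: "i < j \<and> j < m"
        \<comment> \<open>Each Ritz value moves by less than \<open>\<delta>\<close>, while
          neighbouring moduli are at least \<open>2 * \<delta>\<close> apart, so the order survives
          strictly.\<close>
        have "norm (\<theta> j) < norm (lam j) + \<delta>"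
          using near[of j] ij norm_triangle_ineq2[of "\<theta> j" "lam j"] by linarith
        also have "\<dots> \<le> norm (lam i) - \<delta>" using gap_norm[of i j] ij mn by linarith
        also have "\<dots> < norm (\<theta> i)"
          using near[of i] ij norm_triangle_ineq3[of "\<theta> i" "lam i"] by linarith
        finally show "norm (\<theta> j) < norm (\<theta> i)" .
      qed
      have "(\<forall>i<m. i \<noteq> j \<longrightarrow>
                   M7 * (norm (lam m) ^ (2 * k) / (norm (lam i) ^ k * norm (lam j) ^ k)) \<le> norm (z $ i) \<and>
                   norm (z $ i) \<le> M6 * (norm (lam m) ^ (2 * k) / (norm (lam i) ^ k * norm (lam j) ^ k))) \<and>
                (\<forall>i. m \<le> i \<and> i < n \<longrightarrow>
                   M7 * (norm (lam i) ^ k / norm (lam j) ^ k) \<le> norm (z $ i) \<and>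
                   norm (z $ i) \<le> M6 * (norm (lam i) ^ k / norm (lam j) ^ k)) \<and>
                M7 * (norm (lam m) ^ (2 * k) / norm (lam j) ^ (2 * k)) \<le> 1 - norm (z $ j) \<and>
                1 - norm (z $ j) \<le> M6 * (norm (lam m) ^ (2 * k) / norm (lam j) ^ (2 * k))"
        if j: "j < m" and z: "ritz_pair (mat_diag n lam) \<Phi> (\<theta> j) z \<and> euclidean_norm z = 1" for j z
      proof -
        note ritz = ritz_pair_graph_mat[OF mn U V UV z[THEN conjunct1, unfolded \<Phi>]]
        have near_j: "norm (\<theta> j - lam j) < \<delta>" by (rule near[OF j])
        have gap_j: "\<delta> \<le> norm (\<theta> j - lam i)" if "i \<le> m" "i \<noteq> j" for i
          using gap[of j i] near_j that j mn norm_triangle_ineq4[of "\<theta> j - lam i" "\<theta> j - lam j"] by simp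
        have T_j: "norm (\<theta> j - lam i) \<le> T" if "i < n" for i
        proof -
          have "norm (\<theta> j - lam i) \<le> norm (\<theta> j - lam j) + norm (lam j - lam i)"
            using norm_triangle_ineq[of "\<theta> j - lam j" "lam j - lam i"] by simp
          also have "norm (lam j - lam i) \<le> norm (lam j) + norm (lam i)" by (rule norm_triangle_ineq4)
          finally show ?thesis unfolding T_def using near_j lam_le[OF that] lam_le[of j] j mn by linarith
        qed
        have unit: "(\<Sum>i<n. (norm (z $ i))\<^sup>2) = 1"
          using z ritz(1) unfolding euclidean_norm_def L2_set_def by simp
        have normB': "norm (conjugate (B k l i)) = w l i * b k l * a k i" if "l \<in> {m..<n}" "i < m" for l i
          using normB[OF that] norm_conj by simp
        have w_bounds: "w\<^sub>0 \<le> w l i \<and> w l i \<le> Wb" if "l \<in> {m..<n}" "i < m" for l i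
          using w0(2) Wb(2) that by blast
        \<comment> \<open>Unfolded so that the conditions match the expressions behind
          \<open>D\<close> and \<open>s\<close> in \<open>ritz_vector_bounds\<close>.\<close>
        note Kk = K(1)[OF k, unfolded D_def s_def]
        note core = ritz_vector_bounds[where z = "\<lambda>i. z $ i" and B = "B k" and B' = "\<lambda>l i. conjugate (B k l i)"
            and a = "a k" and b = "b k" and w = w and \<theta> = "\<theta> j" and lam = lam,
            OF mn j ritz(3) ritz(2) normB normB' w0(1) w_bounds a01 b01 bm \<delta> gap_j T0 T_j
            Kk[THEN conjunct1] Kk[THEN conjunct2, THEN conjunct1]
            Kk[THEN conjunct2, THEN conjunct2, THEN conjunct1]
            Kk[THEN conjunct2, THEN conjunct2, THEN conjunct2] unit, folded D_def]
        have bounds: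
          "\<And>i. i < m \<Longrightarrow> i \<noteq> j \<Longrightarrow> norm (z $ i) \<le> 2 * D * (a k i * a k j)"
          "\<And>i. i < m \<Longrightarrow> i \<noteq> j \<Longrightarrow> w\<^sub>0\<^sup>2 * \<delta> / (8 * T) * (a k i * a k j) \<le> norm (z $ i)"
          "\<And>l. l \<in> {m..<n} \<Longrightarrow> norm (z $ l) \<le> 2 * Wb * (b k l * a k j)"
          "\<And>l. l \<in> {m..<n} \<Longrightarrow> w\<^sub>0 / 4 * (b k l * a k j) \<le> norm (z $ l)"
          "1 - norm (z $ j) \<le> real n * (2 * (D + Wb))\<^sup>2 * (a k j)\<^sup>2"
          "w\<^sub>0\<^sup>2 / 32 * (a k j)\<^sup>2 \<le> 1 - norm (z $ j)"
          by (rule core; assumption)+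
        have aa: "norm (lam m) ^ (2 * k) / (norm (lam i) ^ k * norm (lam j) ^ k) = a k i * a k j" for i
          by (simp add: a_def power_divide power_mult power2_eq_square power_mult_distrib
              mult_2 power_add)
        have ba: "norm (lam l) ^ k / norm (lam j) ^ k = b k l * a k j" for l
          using lam_m by (simp add: a_def b_def power_divide)
        have a2: "norm (lam m) ^ (2 * k) / norm (lam j) ^ (2 * k) = (a k j)\<^sup>2"
          by (simp add: a_def power_divide power_mult power2_eq_square mult_2 power_add)
        have scale: "M7 * x \<le> y" if "C' * x \<le> y" "M7 \<le> C'" "0 \<le> x" for C' x y
          using that mult_right_mono[of M7 C' x] by linarith
        have scale': "y \<le> M6 * x" if "y \<le> C' * x" "C' \<le> M6" "0 \<le> x" for C' x y
          using that mult_right_mono[of C' M6 x] by linarith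
        have aj: "0 \<le> a k j" using a01[OF j] by (simp add: less_imp_le)
        have F3: "M7 * (norm (lam m) ^ (2 * k) / norm (lam j) ^ (2 * k)) \<le> 1 - norm (z $ j)"
          unfolding a2 by (rule scale[OF bounds(6) M7(3) zero_le_power2])
        have F4: "1 - norm (z $ j) \<le> M6 * (norm (lam m) ^ (2 * k) / norm (lam j) ^ (2 * k))"
          unfolding a2 by (rule scale'[OF bounds(5) M6(3) zero_le_power2])
        have F1: "\<forall>i<m. i \<noteq> j \<longrightarrow>
            M7 * (norm (lam m) ^ (2 * k) / (norm (lam i) ^ k * norm (lam j) ^ k)) \<le> norm (z $ i) \<and>
            norm (z $ i) \<le> M6 * (norm (lam m) ^ (2 * k) / (norm (lam i) ^ k * norm (lam j) ^ k))"
        proof (intro allI impI)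
          fix i assume i: "i < m" "i \<noteq> j"
          have x: "0 \<le> a k i * a k j" using aj a01[OF i(1), of k] by simp
          show "M7 * (norm (lam m) ^ (2 * k) / (norm (lam i) ^ k * norm (lam j) ^ k)) \<le> norm (z $ i) \<and>
              norm (z $ i) \<le> M6 * (norm (lam m) ^ (2 * k) / (norm (lam i) ^ k * norm (lam j) ^ k))"
            unfolding aa using scale[OF bounds(2)[OF i] M7(1) x] scale'[OF bounds(1)[OF i] M6(1) x] ..
        qed
        have F2: "\<forall>i. m \<le> i \<and> i < n \<longrightarrow>
            M7 * (norm (lam i) ^ k / norm (lam j) ^ k) \<le> norm (z $ i) \<and>
            norm (z $ i) \<le> M6 * (norm (lam i) ^ k / norm (lam j) ^ k)"
        proof (intro allI impI)
          fix l assume "m \<le> l \<and> l < n"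
          then have l: "l \<in> {m..<n}" by simp
          have x: "0 \<le> b k l * a k j" using aj b01[OF l, of k] by simp
          show "M7 * (norm (lam l) ^ k / norm (lam j) ^ k) \<le> norm (z $ l) \<and>
              norm (z $ l) \<le> M6 * (norm (lam l) ^ k / norm (lam j) ^ k)"
            unfolding ba using scale[OF bounds(4)[OF l] M7(2) x] scale'[OF bounds(3)[OF l] M6(2) x] ..
        qed
        show ?thesis
          by (rule conjI[OF F1 conjI[OF F2 conjI[OF F3 F4]]])
      qed
      then show "\<forall>j<m. \<forall>z. ritz_pair (mat_diag n lam) \<Phi> (\<theta> j) z \<and> euclidean_norm z = 1 \<longrightarrow>
                (\<forall>i<m. i \<noteq> j \<longrightarrow>
                   M7 * (norm (lam m) ^ (2 * k) / (norm (lam i) ^ k * norm (lam j) ^ k)) \<le> norm (z $ i) \<and>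
                   norm (z $ i) \<le> M6 * (norm (lam m) ^ (2 * k) / (norm (lam i) ^ k * norm (lam j) ^ k))) \<and>
                (\<forall>i. m \<le> i \<and> i < n \<longrightarrow>
                   M7 * (norm (lam i) ^ k / norm (lam j) ^ k) \<le> norm (z $ i) \<and>
                   norm (z $ i) \<le> M6 * (norm (lam i) ^ k / norm (lam j) ^ k)) \<and>
                M7 * (norm (lam m) ^ (2 * k) / norm (lam j) ^ (2 * k)) \<le> 1 - norm (z $ j) \<and>
                1 - norm (z $ j) \<le> M6 * (norm (lam m) ^ (2 * k) / norm (lam j) ^ (2 * k))"
        by blast
    qed
  qed simp
qed

section \<open>The real and the complex instance\<close>

theorem lemma3p1:
  fixes n m :: nat
  assumes "0 < m" and "m < n"
  shows "(\<forall>(lam :: nat \<Rightarrow> real) (X :: real mat).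
     (\<forall>i j. i < j \<and> j < n \<longrightarrow> norm (lam j) < norm (lam i)) \<and>
     (\<forall>i<n. 0 < norm (lam i)) \<and>
     X \<in> carrier_mat n m \<and>
     invertible_mat (submatrix X {..<m} UNIV) \<and>
     (\<forall>i<n - m. \<forall>j<m.
        (submatrix X {m..<n} UNIV * the (mat_inverse (submatrix X {..<m} UNIV))) $$ (i, j) \<noteq> 0)
     \<longrightarrow>
     (\<exists>M6 M7 :: real. \<exists>k7 :: nat. 0 < M6 \<and> 0 < M7 \<and> 0 < k7 \<and>
       (\<forall>k\<ge>k7. \<forall>\<Phi>.
          basis_matrix n m \<Phi> (vec_space.col_space n (mat_diag n lam ^\<^sub>m k * X)) \<longrightarrow>
          (\<exists>\<theta> :: nat \<Rightarrow> real.
             ritz_values (mat_diag n lam) \<Phi> = mset (map \<theta> [0..<m]) \<and>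
             (\<forall>i j. i < j \<and> j < m \<longrightarrow> norm (\<theta> j) < norm (\<theta> i)) \<and>
             (\<forall>j<m. \<forall>z. ritz_pair (mat_diag n lam) \<Phi> (\<theta> j) z \<and> euclidean_norm z = 1 \<longrightarrow>
                (\<forall>i<m. i \<noteq> j \<longrightarrow>
                   M7 * (norm (lam m) ^ (2 * k) / (norm (lam i) ^ k * norm (lam j) ^ k)) \<le> norm (z $ i) \<and>
                   norm (z $ i) \<le> M6 * (norm (lam m) ^ (2 * k) / (norm (lam i) ^ k * norm (lam j) ^ k))) \<and>
                (\<forall>i. m \<le> i \<and> i < n \<longrightarrow>
                   M7 * (norm (lam i) ^ k / norm (lam j) ^ k) \<le> norm (z $ i) \<and>
                   norm (z $ i) \<le> M6 * (norm (lam i) ^ k / norm (lam j) ^ k)) \<and>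
                M7 * (norm (lam m) ^ (2 * k) / norm (lam j) ^ (2 * k)) \<le> 1 - norm (z $ j) \<and>
                1 - norm (z $ j) \<le> M6 * (norm (lam m) ^ (2 * k) / norm (lam j) ^ (2 * k)))))))
   \<and>
   (\<forall>(lam :: nat \<Rightarrow> complex) (X :: complex mat).
     (\<forall>i j. i < j \<and> j < n \<longrightarrow> norm (lam j) < norm (lam i)) \<and>
     (\<forall>i<n. 0 < norm (lam i)) \<and>
     X \<in> carrier_mat n m \<and>
     invertible_mat (submatrix X {..<m} UNIV) \<and>
     (\<forall>i<n - m. \<forall>j<m.
        (submatrix X {m..<n} UNIV * the (mat_inverse (submatrix X {..<m} UNIV))) $$ (i, j) \<noteq> 0)
     \<longrightarrow>
     (\<exists>M6 M7 :: real. \<exists>k7 :: nat. 0 < M6 \<and> 0 < M7 \<and> 0 < k7 \<and>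
       (\<forall>k\<ge>k7. \<forall>\<Phi>.
          basis_matrix n m \<Phi> (vec_space.col_space n (mat_diag n lam ^\<^sub>m k * X)) \<longrightarrow>
          (\<exists>\<theta> :: nat \<Rightarrow> complex.
             ritz_values (mat_diag n lam) \<Phi> = mset (map \<theta> [0..<m]) \<and>
             (\<forall>i j. i < j \<and> j < m \<longrightarrow> norm (\<theta> j) < norm (\<theta> i)) \<and>
             (\<forall>j<m. \<forall>z. ritz_pair (mat_diag n lam) \<Phi> (\<theta> j) z \<and> euclidean_norm z = 1 \<longrightarrow>
                (\<forall>i<m. i \<noteq> j \<longrightarrow>
                   M7 * (norm (lam m) ^ (2 * k) / (norm (lam i) ^ k * norm (lam j) ^ k)) \<le> norm (z $ i) \<and>
                   norm (z $ i) \<le> M6 * (norm (lam m) ^ (2 * k) / (norm (lam i) ^ k * norm (lam j) ^ k))) \<and>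
                (\<forall>i. m \<le> i \<and> i < n \<longrightarrow>
                   M7 * (norm (lam i) ^ k / norm (lam j) ^ k) \<le> norm (z $ i) \<and>
                   norm (z $ i) \<le> M6 * (norm (lam i) ^ k / norm (lam j) ^ k)) \<and>
                M7 * (norm (lam m) ^ (2 * k) / norm (lam j) ^ (2 * k)) \<le> 1 - norm (z $ j) \<and>
                1 - norm (z $ j) \<le> M6 * (norm (lam m) ^ (2 * k) / norm (lam j) ^ (2 * k)))))))"
proof (intro conjI allI impI, goal_cases)
  case (1 lam X)
  note H = 1[THEN conjunct1] 1[THEN conjunct2, THEN conjunct1]
    1[THEN conjunct2, THEN conjunct2, THEN conjunct1]
    1[THEN conjunct2, THEN conjunct2, THEN conjunct2, THEN conjunct1]
    1[THEN conjunct2, THEN conjunct2, THEN conjunct2, THEN conjunct2]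
  show ?case
  proof (rule ritz_asymptotics[OF _ _ assms H])
    show "norm (conjugate x) = norm x" for x :: real by simp
    show "\<exists>\<theta>. proots p = mset (map \<theta> [0..<m]) \<and> (\<forall>j<m. norm (\<theta> j - c j) < \<epsilon>)"
      if "lead_coeff p = 1" "degree p = m" "0 \<le> \<epsilon>"
        "\<And>i j. i < j \<Longrightarrow> j < m \<Longrightarrow> 2 * \<epsilon> \<le> norm (c i - c j)"
        "\<And>j. j < m \<Longrightarrow> norm (poly p (c j)) < \<epsilon> ^ m"
      for p :: "real poly" and c \<epsilon>
      using that by (rule real_proots_near)
  qed
next
  case (2 lam X)
  note H = 2[THEN conjunct1] 2[THEN conjunct2, THEN conjunct1]
    2[THEN conjunct2, THEN conjunct2, THEN conjunct1]
    2[THEN conjunct2, THEN conjunct2, THEN conjunct2, THEN conjunct1]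
    2[THEN conjunct2, THEN conjunct2, THEN conjunct2, THEN conjunct2]
  show ?case
  proof (rule ritz_asymptotics[OF _ _ assms H])
    show "norm (conjugate x) = norm x" for x :: complex by simp
    show "\<exists>\<theta>. proots p = mset (map \<theta> [0..<m]) \<and> (\<forall>j<m. norm (\<theta> j - c j) < \<epsilon>)"
      if "lead_coeff p = 1" "degree p = m" "0 \<le> \<epsilon>"
        "\<And>i j. i < j \<Longrightarrow> j < m \<Longrightarrow> 2 * \<epsilon> \<le> norm (c i - c j)"
        "\<And>j. j < m \<Longrightarrow> norm (poly p (c j)) < \<epsilon> ^ m"
      for p :: "complex poly" and c \<epsilon>
      using that by (rule complex_proots_near)
  qed
qed

end
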